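(* Let $M$ be a countable transitive model of $\mathsf{ZFC}$ and $\mathbb{P}$ an atomless partial order in $M$. If $\mathbb{P}$ is weakly homogeneous in $M$, then $\equiv^\mathbb{P}_M$ is not smooth.
   Context: "$\mathbb{P}$ is a partial order in $M$" means $\mathbb{P}$ and its order are elements of $M$; $\mathbb{P}$ is assumed infinite. $\mathrm{Gen}^\mathbb{P}_M$ is the set of $M$-generic filters $G\subseteq\mathbb{P}$ (filters meeting every dense subset of $\mathbb{P}$ lying in $M$), viewed as a subspace of $2^\mathbb{P}$ with the product topology, and $G\equiv^\mathbb{P}_M H$ iff $M[G]=M[H]$. $\mathbb{P}$ is atomless if every $p$ has two incompatible extensions. $\mathbb{P}$ is weakly homogeneous in $M$ if for all $p,q\in\mathbb{P}$ there is an automorphism $e$ of $\mathbb{P}$ in $M$ with $e(p)$ compatible with $q$. A Borel equivalence relation is smooth if it is Borel reducible to equality on $\mathbb{R}$. *)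

theory Defs
  imports "HOL-Analysis.Analysis" "HOL-Library.Countable_Set_Type"
begin

section \<open>Hereditarily countable sets\<close>

text \<open>
  The type \<open>hset\<close> is the class of hereditarily countable sets. Every element of a countable
  transitive set is hereditarily countable, so countable transitive models are exactly the countable
  transitive subsets of this type that satisfy ZFC. Generic filters and generic extensions are
  again countable sets of hereditarily countable sets.
\<close>

datatype hset = HSet "hset cset"

primrec elts :: "hset \<Rightarrow> hset set" where
  "elts (HSet C) = rcset C"

text \<open>The set with extension \<open>A\<close>; only meaningful for countable \<open>A\<close>.\<close>

definition mkset :: "hset set \<Rightarrow> hset" where
  "mkset A = HSet (acset A)"

lemma countable_elts [simp]: "countable (elts x)"
  by (cases x) simp

lemma elts_mkset [simp]: "countable A \<Longrightarrow> elts (mkset A) = A"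
  by (simp add: mkset_def)

lemma mkset_elts [simp]: "mkset (elts x) = x"
  by (cases x) (simp add: mkset_def)

lemma hset_eq_iff: "x = y \<longleftrightarrow> elts x = elts y"
  by (metis mkset_elts)

lemma wf_elts: "wf {(x, y). x \<in> elts y}"
proof (rule wfUNIVI)
  fix P :: "hset \<Rightarrow> bool" and x
  assume step: "\<forall>x. (\<forall>y. (y, x) \<in> {(x, y). x \<in> elts y} \<longrightarrow> P y) \<longrightarrow> P x"
  show "P x"
  proof (induction x)
    case (HSet C)
    then show ?case using step by simp
  qed
qed

definition kpair :: "hset \<Rightarrow> hset \<Rightarrow> hset" where
  "kpair x y = mkset {mkset {x}, mkset {x, y}}"

lemma kpair_inject [simp]: "kpair x y = kpair x' y' \<longleftrightarrow> x = x' \<and> y = y'"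
proof
  have mk: "mkset A = mkset B \<longleftrightarrow> A = B" if "countable A" "countable B" for A B
    using that by (metis elts_mkset)
  assume "kpair x y = kpair x' y'"
  then show "x = x' \<and> y = y'"
    by (simp add: kpair_def mk doubleton_eq_iff) (auto simp: mk doubleton_eq_iff)
qed simp

definition rel_of :: "hset \<Rightarrow> (hset \<times> hset) set" where
  "rel_of R = {(x, y). kpair x y \<in> elts R}"

definition fun_graph :: "hset \<Rightarrow> (hset \<Rightarrow> hset) \<Rightarrow> hset" where
  "fun_graph A f = mkset ((\<lambda>x. kpair x (f x)) ` elts A)"


section \<open>Countable transitive models of ZFC\<close>

datatype fm = FMem nat nat | FEq nat nat | FNeg fm | FAnd fm fm | FAll nat fm

primrec sat :: "hset set \<Rightarrow> (nat \<Rightarrow> hset) \<Rightarrow> fm \<Rightarrow> bool" where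
  "sat M s (FMem i j) \<longleftrightarrow> s i \<in> elts (s j)"
| "sat M s (FEq i j) \<longleftrightarrow> s i = s j"
| "sat M s (FNeg \<phi>) \<longleftrightarrow> \<not> sat M s \<phi>"
| "sat M s (FAnd \<phi> \<psi>) \<longleftrightarrow> sat M s \<phi> \<and> sat M s \<psi>"
| "sat M s (FAll i \<phi>) \<longleftrightarrow> (\<forall>x\<in>M. sat M (s(i := x)) \<phi>)"

text \<open>
  Each axiom below is written as its satisfaction in the structure \<open>(M, \<in>)\<close>. In the two schemas,
  the parameters of the formula \<open>\<phi>\<close> are supplied by the assignment \<open>s\<close>.
\<close>

definition ax_extensionality :: "hset set \<Rightarrow> bool" where
  "ax_extensionality M \<longleftrightarrow>
     (\<forall>x\<in>M. \<forall>y\<in>M. (\<forall>z\<in>M. z \<in> elts x \<longleftrightarrow> z \<in> elts y) \<longrightarrow> x = y)"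

definition ax_foundation :: "hset set \<Rightarrow> bool" where
  "ax_foundation M \<longleftrightarrow>
     (\<forall>x\<in>M. (\<exists>y\<in>M. y \<in> elts x) \<longrightarrow>
        (\<exists>y\<in>M. y \<in> elts x \<and> \<not> (\<exists>z\<in>M. z \<in> elts x \<and> z \<in> elts y)))"

definition ax_pairing :: "hset set \<Rightarrow> bool" where
  "ax_pairing M \<longleftrightarrow>
     (\<forall>x\<in>M. \<forall>y\<in>M. \<exists>z\<in>M. \<forall>u\<in>M. u \<in> elts z \<longleftrightarrow> u = x \<or> u = y)"

definition ax_union :: "hset set \<Rightarrow> bool" where
  "ax_union M \<longleftrightarrow>
     (\<forall>x\<in>M. \<exists>z\<in>M. \<forall>u\<in>M. u \<in> elts z \<longleftrightarrow> (\<exists>y\<in>M. y \<in> elts x \<and> u \<in> elts y))"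

definition ax_power_set :: "hset set \<Rightarrow> bool" where
  "ax_power_set M \<longleftrightarrow>
     (\<forall>x\<in>M. \<exists>z\<in>M. \<forall>u\<in>M. u \<in> elts z \<longleftrightarrow> (\<forall>v\<in>M. v \<in> elts u \<longrightarrow> v \<in> elts x))"

definition ax_infinity :: "hset set \<Rightarrow> bool" where
  "ax_infinity M \<longleftrightarrow>
     (\<exists>w\<in>M. (\<exists>z\<in>M. z \<in> elts w \<and> (\<forall>u\<in>M. u \<notin> elts z)) \<and>
        (\<forall>x\<in>M. x \<in> elts w \<longrightarrow>
           (\<exists>y\<in>M. y \<in> elts w \<and> (\<forall>u\<in>M. u \<in> elts y \<longleftrightarrow> u \<in> elts x \<or> u = x))))"

definition ax_separation :: "hset set \<Rightarrow> bool" where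
  "ax_separation M \<longleftrightarrow>
     (\<forall>\<phi> s. range s \<subseteq> M \<longrightarrow>
        (\<forall>a\<in>M. \<exists>b\<in>M. \<forall>x\<in>M. x \<in> elts b \<longleftrightarrow> x \<in> elts a \<and> sat M (s(0 := x)) \<phi>))"

definition ax_replacement :: "hset set \<Rightarrow> bool" where
  "ax_replacement M \<longleftrightarrow>
     (\<forall>\<phi> s. range s \<subseteq> M \<longrightarrow>
        (\<forall>a\<in>M. (\<forall>x\<in>M. x \<in> elts a \<longrightarrow> (\<exists>!y. y \<in> M \<and> sat M (s(0 := x, 1 := y)) \<phi>)) \<longrightarrow>
           (\<exists>b\<in>M. \<forall>y\<in>M. y \<in> elts b \<longleftrightarrow>
              (\<exists>x\<in>M. x \<in> elts a \<and> sat M (s(0 := x, 1 := y)) \<phi>))))"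

definition ax_choice :: "hset set \<Rightarrow> bool" where
  "ax_choice M \<longleftrightarrow>
     (\<forall>a\<in>M.
        (\<forall>x\<in>M. x \<in> elts a \<longrightarrow> (\<exists>u\<in>M. u \<in> elts x)) \<and>
        (\<forall>x\<in>M. \<forall>y\<in>M. x \<in> elts a \<and> y \<in> elts a \<and> x \<noteq> y \<longrightarrow>
           \<not> (\<exists>u\<in>M. u \<in> elts x \<and> u \<in> elts y)) \<longrightarrow>
        (\<exists>c\<in>M. \<forall>x\<in>M. x \<in> elts a \<longrightarrow> (\<exists>!u. u \<in> M \<and> u \<in> elts x \<and> u \<in> elts c)))"

definition models_ZFC :: "hset set \<Rightarrow> bool" where
  "models_ZFC M \<longleftrightarrow>
     ax_extensionality M \<and> ax_foundation M \<and> ax_pairing M \<and> ax_union M \<and> ax_power_set M \<and>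
     ax_infinity M \<and> ax_separation M \<and> ax_replacement M \<and> ax_choice M"

definition ctm :: "hset set \<Rightarrow> bool" where
  "ctm M \<longleftrightarrow> countable M \<and> (\<forall>x\<in>M. elts x \<subseteq> M) \<and> models_ZFC M"


section \<open>Partial orders and generic filters\<close>

text \<open>A partial order is a pair of sets \<open>P\<close>, \<open>R\<close>, where \<open>(p, q) \<in> rel_of R\<close> means
  that \<open>p\<close> extends (is stronger than) \<open>q\<close>.\<close>

definition partial_order_in :: "hset set \<Rightarrow> hset \<Rightarrow> hset \<Rightarrow> bool" where
  "partial_order_in M P R \<longleftrightarrow>
     P \<in> M \<and> R \<in> M \<and> infinite (elts P) \<and>
     (\<forall>z\<in>elts R. \<exists>x y. z = kpair x y) \<and> partial_order_on (elts P) (rel_of R)"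

definition compatible :: "hset \<Rightarrow> hset \<Rightarrow> hset \<Rightarrow> hset \<Rightarrow> bool" where
  "compatible P R p q \<longleftrightarrow> (\<exists>r\<in>elts P. (r, p) \<in> rel_of R \<and> (r, q) \<in> rel_of R)"

definition atomless :: "hset \<Rightarrow> hset \<Rightarrow> bool" where
  "atomless P R \<longleftrightarrow>
     (\<forall>p\<in>elts P. \<exists>q\<in>elts P. \<exists>r\<in>elts P.
        (q, p) \<in> rel_of R \<and> (r, p) \<in> rel_of R \<and> \<not> compatible P R q r)"

definition automorphism :: "hset \<Rightarrow> hset \<Rightarrow> (hset \<Rightarrow> hset) \<Rightarrow> bool" where
  "automorphism P R e \<longleftrightarrow>
     bij_betw e (elts P) (elts P) \<and>
     (\<forall>p\<in>elts P. \<forall>q\<in>elts P. (p, q) \<in> rel_of R \<longleftrightarrow> (e p, e q) \<in> rel_of R)"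

definition weakly_homogeneous_in :: "hset set \<Rightarrow> hset \<Rightarrow> hset \<Rightarrow> bool" where
  "weakly_homogeneous_in M P R \<longleftrightarrow>
     (\<forall>p\<in>elts P. \<forall>q\<in>elts P. \<exists>e. automorphism P R e \<and> fun_graph P e \<in> M \<and>
        compatible P R (e p) q)"

definition dense_in_order :: "hset \<Rightarrow> hset \<Rightarrow> hset set \<Rightarrow> bool" where
  "dense_in_order P R D \<longleftrightarrow>
     D \<subseteq> elts P \<and> (\<forall>p\<in>elts P. \<exists>d\<in>D. (d, p) \<in> rel_of R)"

definition filter_in_order :: "hset \<Rightarrow> hset \<Rightarrow> hset set \<Rightarrow> bool" where
  "filter_in_order P R G \<longleftrightarrow>
     G \<subseteq> elts P \<and> G \<noteq> {} \<and>
     (\<forall>p\<in>G. \<forall>q\<in>elts P. (p, q) \<in> rel_of R \<longrightarrow> q \<in> G) \<and>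
     (\<forall>p\<in>G. \<forall>q\<in>G. \<exists>r\<in>G. (r, p) \<in> rel_of R \<and> (r, q) \<in> rel_of R)"

definition Gen :: "hset set \<Rightarrow> hset \<Rightarrow> hset \<Rightarrow> hset set set" where
  "Gen M P R =
     {G. filter_in_order P R G \<and> (\<forall>D\<in>M. dense_in_order P R (elts D) \<longrightarrow> G \<inter> elts D \<noteq> {})}"


section \<open>Generic extensions\<close>

inductive is_name :: "hset \<Rightarrow> hset \<Rightarrow> bool" for P where
  "(\<And>x. x \<in> elts \<tau> \<Longrightarrow> \<exists>\<sigma> p. x = kpair \<sigma> p \<and> p \<in> elts P \<and> is_name P \<sigma>) \<Longrightarrow> is_name P \<tau>"

lemma kpair_fst_below:
  assumes "kpair x y \<in> elts z"
  shows "(x, z) \<in> {(x, y). x \<in> elts y}\<^sup>+"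
proof -
  have "x \<in> elts (mkset {x})" "mkset {x} \<in> elts (kpair x y)"
    by (simp_all add: kpair_def)
  with assms show ?thesis
    by (intro trancl_into_trancl[OF trancl_into_trancl[OF r_into_trancl]]) auto
qed

function val :: "hset set \<Rightarrow> hset \<Rightarrow> hset" where
  "val G \<tau> = mkset (val G ` {\<sigma>. \<exists>p\<in>G. kpair \<sigma> p \<in> elts \<tau>})"
  by auto
termination
  by (relation "inv_image ({(x, y). x \<in> elts y}\<^sup>+) snd")
    (auto simp: wf_elts intro!: wf_inv_image wf_trancl dest: kpair_fst_below)

declare val.simps [simp del]

text \<open>The set handed to \<open>mkset\<close> in the definition of \<open>val\<close> is indeed countable.\<close>

lemma elts_val: "elts (val G \<tau>) = val G ` {\<sigma>. \<exists>p\<in>G. kpair \<sigma> p \<in> elts \<tau>}"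
proof -
  have "{\<sigma>. \<exists>p\<in>G. kpair \<sigma> p \<in> elts \<tau>} \<subseteq> (\<lambda>z. THE \<sigma>. \<exists>p. z = kpair \<sigma> p) ` elts \<tau>"
  proof
    fix \<sigma> assume "\<sigma> \<in> {\<sigma>. \<exists>p\<in>G. kpair \<sigma> p \<in> elts \<tau>}"
    then obtain p where p: "kpair \<sigma> p \<in> elts \<tau>" by blast
    have "\<sigma> = (THE \<sigma>'. \<exists>p'. kpair \<sigma> p = kpair \<sigma>' p')" by simp
    then show "\<sigma> \<in> (\<lambda>z. THE \<sigma>. \<exists>p. z = kpair \<sigma> p) ` elts \<tau>" using p by (rule image_eqI)
  qed
  then have "countable {\<sigma>. \<exists>p\<in>G. kpair \<sigma> p \<in> elts \<tau>}"
    by (rule countable_subset) simp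
  then show ?thesis
    by (subst val.simps) simp
qed

definition gen_ext :: "hset set \<Rightarrow> hset \<Rightarrow> hset set \<Rightarrow> hset set" where
  "gen_ext M P G = {val G \<tau> | \<tau>. \<tau> \<in> M \<and> is_name P \<tau>}"

definition gen_equiv :: "hset set \<Rightarrow> hset \<Rightarrow> hset set \<Rightarrow> hset set \<Rightarrow> bool" where
  "gen_equiv M P G H \<longleftrightarrow> gen_ext M P G = gen_ext M P H"


section \<open>Borel reducibility\<close>

text \<open>The product topology on \<open>2\<close> to the power \<open>A\<close>, transported to the power set of \<open>A\<close>
  along characteristic functions.\<close>

definition powerset_topology :: "'a set \<Rightarrow> 'a set topology" where
  "powerset_topology A =
     pullback_topology (Pow A) (\<lambda>G. \<lambda>p\<in>A. p \<in> G)
       (product_topology (\<lambda>_. discrete_topology (UNIV :: bool set)) A)"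

definition Gen_topology :: "hset set \<Rightarrow> hset \<Rightarrow> hset \<Rightarrow> hset set topology" where
  "Gen_topology M P R = subtopology (powerset_topology (elts P)) (Gen M P R)"

lemma topspace_powerset_topology [simp]: "topspace (powerset_topology A) = Pow A"
  by (auto simp: powerset_topology_def topspace_pullback_topology)

lemma topspace_Gen_topology [simp]: "topspace (Gen_topology M P R) = Gen M P R"
  by (auto simp: Gen_topology_def Gen_def filter_in_order_def)

definition borel_of :: "'a topology \<Rightarrow> 'a measure" where
  "borel_of X = sigma (topspace X) {U. openin X U}"

definition borel_reducible ::
  "'a topology \<Rightarrow> ('a \<Rightarrow> 'a \<Rightarrow> bool) \<Rightarrow> 'b topology \<Rightarrow> ('b \<Rightarrow> 'b \<Rightarrow> bool) \<Rightarrow> bool" where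
  "borel_reducible X E Y F \<longleftrightarrow>
     (\<exists>f. f \<in> borel_of X \<rightarrow>\<^sub>M borel_of Y \<and>
        (\<forall>x\<in>topspace X. \<forall>y\<in>topspace X. E x y \<longleftrightarrow> F (f x) (f y)))"

text \<open>A relation that is Borel reducible to equality on the reals is automatically a Borel
  equivalence relation, so this need not be required separately.\<close>

definition smooth :: "'a topology \<Rightarrow> ('a \<Rightarrow> 'a \<Rightarrow> bool) \<Rightarrow> bool" where
  "smooth X E \<longleftrightarrow> borel_reducible X E (euclidean :: real topology) (=)"

end

theory Submission
  imports Defs
begin

text \<open>
  Suppose that \<open>f\<close> is a Borel reduction of \<open>\<equiv>\<close> to equality of reals. An automorphism \<open>e \<in> M\<close> acts on
  the generic filters with \<open>M[e ` G] = M[G]\<close>, so by weak homogeneity an \<open>\<equiv>\<close>-invariant Borel set of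
  generic filters is meagre or comeagre. Applied to the sublevel sets of \<open>f\<close> at rational numbers,
  this makes \<open>f\<close> constant on a comeagre set, so some \<open>\<equiv>\<close>-class is comeagre. But the class of \<open>G\<close> is
  contained in the countable set \<open>M[G]\<close>, and points are nowhere dense since the order is atomless;
  this contradicts the Baire category theorem, here in the form of the Rasiowa-Sikorski lemma.
\<close>

section \<open>Closure properties of the model\<close>

text \<open>The model is accessible only through satisfaction of formulas of type \<open>fm\<close>,
  so every set that must lie in \<open>M\<close> has to be cut out by an explicit formula. For pairs
  and relations this is cheap. The costly points are that moving \<open>G\<close> along
  \<open>e\<close> does not change the extension and that \<open>G\<close> is coded in its own
  extension: both need functions on names that are defined by transfinite recursion and have values
  in \<open>M\<close>. One recursion theorem relative to \<open>M\<close> (locale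
  \<open>name_recursion\<close>) serves both. In the formulas, slots 0 and 1 are the variables of
  the schemas, slot 2 normally carries the recursion parameter, and high numbers such as 10 or 20
  are bound variables. Category is handled outside \<open>M\<close>: countable families of dense
  sets, which may lie outside \<open>M\<close>, stand for comeagre sets.\<close>

definition FOr :: "fm \<Rightarrow> fm \<Rightarrow> fm" where
  "FOr \<phi> \<psi> = FNeg (FAnd (FNeg \<phi>) (FNeg \<psi>))"

definition FImp :: "fm \<Rightarrow> fm \<Rightarrow> fm" where
  "FImp \<phi> \<psi> = FNeg (FAnd \<phi> (FNeg \<psi>))"

definition FIff :: "fm \<Rightarrow> fm \<Rightarrow> fm" where
  "FIff \<phi> \<psi> = FAnd (FImp \<phi> \<psi>) (FImp \<psi> \<phi>)"

definition FEx :: "nat \<Rightarrow> fm \<Rightarrow> fm" where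
  "FEx i \<phi> = FNeg (FAll i (FNeg \<phi>))"

lemma sat_connectives [simp]:
  "sat M s (FOr \<phi> \<psi>) \<longleftrightarrow> sat M s \<phi> \<or> sat M s \<psi>"
  "sat M s (FImp \<phi> \<psi>) \<longleftrightarrow> (sat M s \<phi> \<longrightarrow> sat M s \<psi>)"
  "sat M s (FIff \<phi> \<psi>) \<longleftrightarrow> (sat M s \<phi> \<longleftrightarrow> sat M s \<psi>)"
  "sat M s (FEx i \<phi>) \<longleftrightarrow> (\<exists>x\<in>M. sat M (s(i := x)) \<phi>)"
  by (auto simp: FOr_def FImp_def FIff_def FEx_def)

text \<open>\<open>Suc (i + j + k)\<close> is distinct from \<open>i\<close>, \<open>j\<close> and
  \<open>k\<close>, so the quantifier captures none of them; the next two formulas use the same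
  device.\<close>

definition FUpair :: "nat \<Rightarrow> nat \<Rightarrow> nat \<Rightarrow> fm" where
  "FUpair i j k = (let n = Suc (i + j + k) in FAll n (FIff (FMem n i) (FOr (FEq n j) (FEq n k))))"

definition FPair :: "nat \<Rightarrow> nat \<Rightarrow> nat \<Rightarrow> fm" where
  "FPair i j k =
     (let n = Suc (i + j + k) in FAll n (FIff (FMem n i) (FOr (FUpair n j j) (FUpair n j k))))"

definition FPairMem :: "nat \<Rightarrow> nat \<Rightarrow> nat \<Rightarrow> fm" where
  "FPairMem j k i = (let n = Suc (i + j + k) in FEx n (FAnd (FPair n j k) (FMem n i)))"

definition assignment :: "hset set \<Rightarrow> (nat \<Rightarrow> hset) \<Rightarrow> bool" where
  "assignment M s \<longleftrightarrow> range s \<subseteq> M"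

lemma assignment_upd [simp]: "assignment M s \<Longrightarrow> x \<in> M \<Longrightarrow> assignment M (s(i := x))"
  by (auto simp: assignment_def)

lemma assignment_const [simp]: "x \<in> M \<Longrightarrow> assignment M (\<lambda>_. x)"
  by (auto simp: assignment_def)

lemma assignmentD [simp]: "assignment M s \<Longrightarrow> s i \<in> M"
  by (auto simp: assignment_def)

abbreviation mem_rel :: "(hset \<times> hset) set" where
  "mem_rel \<equiv> {(x, y). x \<in> elts y}"

lemma wf_mem_trancl: "wf (mem_rel\<^sup>+)"
  by (rule wf_trancl[OF wf_elts])

lemma elts_kpair [simp]: "elts (kpair x y) = {mkset {x}, mkset {x, y}}"
  by (simp add: kpair_def)

locale ctm_model =
  fixes M :: "hset set"
  assumes ctm: "ctm M"
begin

lemma countable_M: "countable M"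
  using ctm by (simp add: ctm_def)

lemma transM: "x \<in> elts y \<Longrightarrow> y \<in> M \<Longrightarrow> x \<in> M"
  using ctm by (auto simp: ctm_def)

lemma mem_trancl_in_M: "(x, y) \<in> mem_rel\<^sup>+ \<Longrightarrow> y \<in> M \<Longrightarrow> x \<in> M"
  by (induction rule: trancl_induct) (use transM in \<open>simp, blast\<close>)+

lemma elts_subset_M: "y \<in> M \<Longrightarrow> elts y \<subseteq> M"
  using transM by blast

text \<open>By transitivity a set in \<open>M\<close> is determined by its members in
  \<open>M\<close>. Hence the witness of a relativised axiom is the true pair, union or
  image.\<close>

lemma eqI_in_M: "x \<in> M \<Longrightarrow> countable A \<Longrightarrow> A \<subseteq> M \<Longrightarrow> (\<And>u. u \<in> M \<Longrightarrow> u \<in> elts x \<longleftrightarrow> u \<in> A) \<Longrightarrow> x = mkset A"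
  unfolding hset_eq_iff using elts_subset_M by auto

lemma eq_mkset_iff_in_M:
  assumes "x \<in> M" "countable A" "A \<subseteq> M"
  shows "x = mkset A \<longleftrightarrow> (\<forall>u\<in>M. u \<in> elts x \<longleftrightarrow> u \<in> A)"
  using eqI_in_M[OF assms] assms(2) by auto

lemma upair_in_M [simp]: "x \<in> M \<Longrightarrow> y \<in> M \<Longrightarrow> mkset {x, y} \<in> M"
proof -
  assume xy: "x \<in> M" "y \<in> M"
  have "ax_pairing M" using ctm by (simp add: ctm_def models_ZFC_def)
  from this[unfolded ax_pairing_def, THEN bspec, THEN bspec, OF xy]
  obtain z where "z \<in> M" "\<forall>u\<in>M. u \<in> elts z \<longleftrightarrow> u = x \<or> u = y" ..
  moreover from this xy have "z = mkset {x, y}" by (intro eqI_in_M) auto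
  ultimately show ?thesis by simp
qed

lemma singleton_in_M [simp]: "x \<in> M \<Longrightarrow> mkset {x} \<in> M"
  using upair_in_M[of x x] by simp

lemma kpair_in_M [simp]: "x \<in> M \<Longrightarrow> y \<in> M \<Longrightarrow> kpair x y \<in> M"
  by (simp add: kpair_def)

lemma kpair_in_M_iff: "kpair x y \<in> M \<longleftrightarrow> x \<in> M \<and> y \<in> M"
proof
  assume *: "kpair x y \<in> M"
  then have "mkset {x, y} \<in> M" by (rule transM[rotated]) simp
  then show "x \<in> M \<and> y \<in> M" using transM[of _ "mkset {x, y}"] by simp
qed simp

lemma kpair_memD: "kpair x y \<in> elts z \<Longrightarrow> z \<in> M \<Longrightarrow> x \<in> M \<and> y \<in> M"
  using kpair_in_M_iff[of x y] transM[of "kpair x y" z] by blast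

lemma Union_in_M [simp]:
  assumes "x \<in> M"
  shows "mkset (\<Union>(elts ` elts x)) \<in> M"
proof -
  have "ax_union M" using ctm by (simp add: ctm_def models_ZFC_def)
  from this[unfolded ax_union_def, THEN bspec, OF assms]
  obtain z where z: "z \<in> M" "\<forall>u\<in>M. u \<in> elts z \<longleftrightarrow> (\<exists>y\<in>M. y \<in> elts x \<and> u \<in> elts y)" ..
  have "z = mkset (\<Union>(elts ` elts x))"
  proof (rule eqI_in_M)
    show "\<Union>(elts ` elts x) \<subseteq> M" using assms transM by blast
    show "u \<in> elts z \<longleftrightarrow> u \<in> \<Union>(elts ` elts x)" if "u \<in> M" for u
      using that z(2) assms transM by blast
  qed (use z in auto)
  with z show ?thesis by simp
qed

lemma Un_in_M [simp]:
  assumes "x \<in> M" "y \<in> M"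
  shows "mkset (elts x \<union> elts y) \<in> M"
  using Union_in_M[of "mkset {x, y}"] assms by simp

lemma powerset_in_M:
  assumes "x \<in> M"
  obtains z where "z \<in> M" "\<And>u. u \<in> M \<Longrightarrow> elts u \<subseteq> elts x \<Longrightarrow> u \<in> elts z"
proof -
  have "ax_power_set M" using ctm by (simp add: ctm_def models_ZFC_def)
  from this[unfolded ax_power_set_def, THEN bspec, OF assms]
  obtain z where "z \<in> M" "\<forall>u\<in>M. u \<in> elts z \<longleftrightarrow> (\<forall>v\<in>M. v \<in> elts u \<longrightarrow> v \<in> elts x)" ..
  then show ?thesis by (intro that) auto
qed

lemma separation_in_M:
  assumes "a \<in> M" "assignment M s"
    and "\<And>x. x \<in> M \<Longrightarrow> x \<in> elts a \<Longrightarrow> sat M (s(0 := x)) \<phi> \<longleftrightarrow> Q x"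
  shows "mkset {x \<in> elts a. Q x} \<in> M"
proof -
  have "ax_separation M" using ctm by (simp add: ctm_def models_ZFC_def)
  from this[unfolded ax_separation_def, THEN spec, THEN spec, THEN mp, THEN bspec,
      OF assms(2)[unfolded assignment_def] assms(1)]
  obtain b where b: "b \<in> M"
    "\<forall>x\<in>M. x \<in> elts b \<longleftrightarrow> x \<in> elts a \<and> sat M (s(0 := x)) \<phi>" ..
  have "b = mkset {x \<in> elts a. Q x}"
  proof (rule eqI_in_M)
    show "{x \<in> elts a. Q x} \<subseteq> M" using assms(1) transM by blast
    show "countable {x \<in> elts a. Q x}" by (rule countable_subset[OF _ countable_elts[of a]]) auto
  qed (use b assms in auto)
  with b show ?thesis by simp
qed

lemma replacement_in_M:
  assumes "a \<in> M" "assignment M s"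
    and "\<And>x. x \<in> elts a \<Longrightarrow> f x \<in> M"
    and "\<And>x y. x \<in> M \<Longrightarrow> x \<in> elts a \<Longrightarrow> y \<in> M \<Longrightarrow> sat M (s(0 := x, 1 := y)) \<phi> \<longleftrightarrow> y = f x"
  shows "mkset (f ` elts a) \<in> M"
proof -
  have rep: "ax_replacement M" using ctm by (simp add: ctm_def models_ZFC_def)
  have "\<forall>x\<in>M. x \<in> elts a \<longrightarrow> (\<exists>!y. y \<in> M \<and> sat M (s(0 := x, 1 := y)) \<phi>)"
    using assms by (intro ballI impI ex1I[of _ "f _"]) auto
  from rep[unfolded ax_replacement_def, THEN spec, THEN spec, THEN mp, THEN bspec, THEN mp,
      OF assms(2)[unfolded assignment_def] assms(1) this]
  obtain b where b: "b \<in> M"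
    "\<forall>y\<in>M. y \<in> elts b \<longleftrightarrow> (\<exists>x\<in>M. x \<in> elts a \<and> sat M (s(0 := x, 1 := y)) \<phi>)" ..
  have "b = mkset (f ` elts a)"
  proof (rule eqI_in_M)
    show "f ` elts a \<subseteq> M" using assms(3) by blast
    show "u \<in> elts b \<longleftrightarrow> u \<in> f ` elts a" if "u \<in> M" for u
      using b(2) that assms(4) transM[OF _ assms(1)] by auto
  qed (use b in auto)
  with b show ?thesis by simp
qed

lemma sat_FUpair [simp]:
  assumes s: "assignment M s"
  shows "sat M s (FUpair i j k) \<longleftrightarrow> s i = mkset {s j, s k}"
  using eq_mkset_iff_in_M[of "s i" "{s j, s k}"] s
  by (simp add: FUpair_def Let_def)

lemma sat_FPair [simp]:
  assumes s: "assignment M s"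
  shows "sat M s (FPair i j k) \<longleftrightarrow> s i = kpair (s j) (s k)"
  using eq_mkset_iff_in_M[of "s i" "{mkset {s j}, mkset {s j, s k}}"] s
  by (simp add: FPair_def Let_def kpair_def)

lemma sat_FPairMem [simp]:
  assumes s: "assignment M s"
  shows "sat M s (FPairMem j k i) \<longleftrightarrow> kpair (s j) (s k) \<in> elts (s i)"
  using s by (simp add: FPairMem_def Let_def)

text \<open>A Kuratowski pair of members of \<open>a\<close> and \<open>b\<close> is a set of
  subsets of their union, so two power sets bound the relation and separation cuts it out. Slots 20
  and 21 receive the two components.\<close>

lemma relation_in_M:
  assumes a: "a \<in> M" and b: "b \<in> M" and s: "assignment M s"
    and Q: "\<And>y q. Q y q \<Longrightarrow> y \<in> elts a \<and> q \<in> elts b"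
    and sat: "\<And>y q. y \<in> M \<Longrightarrow> q \<in> M \<Longrightarrow> sat M (s(0 := kpair y q, 20 := y, 21 := q)) \<phi> \<longleftrightarrow> Q y q"
  shows "mkset {kpair y q | y q. Q y q} \<in> M"
proof -
  have "mkset (elts a \<union> elts b) \<in> M" using a b by simp
  then obtain z1 where z1: "z1 \<in> M" "\<And>u. u \<in> M \<Longrightarrow> elts u \<subseteq> elts a \<union> elts b \<Longrightarrow> u \<in> elts z1"
    by (rule powerset_in_M) auto
  then obtain z where z: "z \<in> M" "\<And>u. u \<in> M \<Longrightarrow> elts u \<subseteq> elts z1 \<Longrightarrow> u \<in> elts z"
    by (metis powerset_in_M)
  have QM: "y \<in> M \<and> q \<in> M" if "Q y q" for y q using Q that a b transM by blast
  have in_z: "kpair y q \<in> elts z" if "Q y q" for y q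
    using Q[OF that] QM[OF that] by (intro z) (auto intro!: z1)
  have "mkset {x \<in> elts z. \<exists>y q. x = kpair y q \<and> Q y q} \<in> M"
    by (rule separation_in_M[OF z(1) s, where \<phi> = "FEx 20 (FEx 21 (FAnd (FPair 0 20 21) \<phi>))"])
      (use s sat QM in auto)
  also have "{x \<in> elts z. \<exists>y q. x = kpair y q \<and> Q y q} = {kpair y q | y q. Q y q}"
    using in_z by auto
  finally show ?thesis .
qed

end

section \<open>Recursive construction of names in the model\<close>

text \<open>The common form of all recursions on names used here. The guard by the transitive
  closure gives termination for arbitrary \<open>\<Phi>\<close>; transitive closure rather than
  membership, because a name sits inside a pair and so is not itself an element.\<close>

function relabel :: "(hset \<Rightarrow> hset \<Rightarrow> hset \<Rightarrow> bool) \<Rightarrow> hset \<Rightarrow> hset" where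
  "relabel \<Phi> x =
     mkset ((\<lambda>(y, q). kpair (relabel \<Phi> y) q) ` {(y, q). (y, x) \<in> mem_rel\<^sup>+ \<and> \<Phi> x y q})"
  by auto
termination
  by (relation "inv_image (mem_rel\<^sup>+) snd") (auto simp: wf_mem_trancl intro!: wf_inv_image)

declare relabel.simps [simp del]

text \<open>\<open>F\<Phi>\<close> defines \<open>\<Phi>\<close> in \<open>M\<close> from the
  parameter \<open>c\<close> in slot 2. The assumption \<open>below\<close> makes the guard of
  \<open>relabel\<close> vacuous, and \<open>bounded\<close> makes each support a set of
  \<open>M\<close>, over which replacement can be applied.\<close>

locale name_recursion = ctm_model +
  fixes c :: hset and \<Phi> :: "hset \<Rightarrow> hset \<Rightarrow> hset \<Rightarrow> bool" and F\<Phi> :: "nat \<Rightarrow> nat \<Rightarrow> nat \<Rightarrow> fm"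
  assumes param_in_M: "c \<in> M"
    and sat_F\<Phi> [simp]:
      "assignment M s \<Longrightarrow> s 2 = c \<Longrightarrow> sat M s (F\<Phi> i j k) \<longleftrightarrow> \<Phi> (s i) (s j) (s k)"
    and below: "\<Phi> x y q \<Longrightarrow> (y, x) \<in> mem_rel\<^sup>+"
    and bounded: "x \<in> M \<Longrightarrow> \<exists>a\<in>M. \<exists>b\<in>M. \<forall>y q. \<Phi> x y q \<longrightarrow> y \<in> elts a \<and> q \<in> elts b"
begin

abbreviation F :: "hset \<Rightarrow> hset" where "F \<equiv> relabel \<Phi>"

definition support :: "hset \<Rightarrow> hset" where
  "support x = mkset {kpair y q | y q. \<Phi> x y q}"

lemma \<Phi>_in_M: "\<Phi> x y q \<Longrightarrow> x \<in> M \<Longrightarrow> y \<in> M \<and> q \<in> M"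
  using bounded[of x] transM by blast

lemma countable_\<Phi>: "x \<in> M \<Longrightarrow> countable {(y, q). \<Phi> x y q}"
proof -
  assume "x \<in> M"
  then obtain a b where "\<forall>y q. \<Phi> x y q \<longrightarrow> y \<in> elts a \<and> q \<in> elts b" using bounded by blast
  then have "{(y, q). \<Phi> x y q} \<subseteq> elts a \<times> elts b" by auto
  then show ?thesis by (rule countable_subset) simp
qed

lemma elts_F: "x \<in> M \<Longrightarrow> elts (F x) = {kpair (F y) q | y q. \<Phi> x y q}"
proof -
  assume "x \<in> M"
  moreover have "{(y, q). (y, x) \<in> mem_rel\<^sup>+ \<and> \<Phi> x y q} = {(y, q). \<Phi> x y q}"
    using below by auto
  ultimately have "elts (F x) = (\<lambda>(y, q). kpair (F y) q) ` {(y, q). \<Phi> x y q}"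
    using countable_\<Phi> by (subst relabel.simps) simp
  then show ?thesis by auto
qed

lemma support_in_M: "x \<in> M \<Longrightarrow> support x \<in> M"
proof -
  assume x: "x \<in> M"
  then obtain a b where ab: "a \<in> M" "b \<in> M" "\<And>y q. \<Phi> x y q \<Longrightarrow> y \<in> elts a \<and> q \<in> elts b"
    using bounded by blast
  show ?thesis unfolding support_def
    by (rule relation_in_M[OF ab(1,2) _ ab(3), where s = "(\<lambda>_. c)(3 := x)" and \<phi> = "F\<Phi> 3 20 21"])
      (use x param_in_M in auto)
qed

lemma elts_support: "x \<in> M \<Longrightarrow> elts (support x) = {kpair y q | y q. \<Phi> x y q}"
proof -
  assume "x \<in> M"
  moreover have "{kpair y q | y q. \<Phi> x y q} = (\<lambda>(y, q). kpair y q) ` {(y, q). \<Phi> x y q}" by auto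
  ultimately show ?thesis by (simp add: support_def countable_\<Phi>)
qed

text \<open>The approximations from the classical proof of the recursion theorem: the domain is
  closed under \<open>\<Phi>\<close>-predecessors and the recursion equation holds at each point.
  Single-valuedness is derived in \<open>attempt_value\<close>.\<close>

definition attempt :: "hset \<Rightarrow> bool" where
  "attempt g \<longleftrightarrow> (\<forall>a\<in>M. \<forall>b\<in>M. kpair a b \<in> elts g \<longrightarrow>
     (\<forall>w\<in>M. w \<in> elts b \<longleftrightarrow>
        (\<exists>y\<in>M. \<exists>q\<in>M. \<exists>b'\<in>M. \<Phi> a y q \<and> kpair y b' \<in> elts g \<and> w = kpair b' q)) \<and>
     (\<forall>y\<in>M. \<forall>q\<in>M. \<Phi> a y q \<longrightarrow> (\<exists>b'\<in>M. kpair y b' \<in> elts g)))"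

definition FAttempt :: "nat \<Rightarrow> fm" where
  "FAttempt i = FAll 10 (FAll 11 (FImp (FPairMem 10 11 i) (FAnd
     (FAll 12 (FIff (FMem 12 11)
        (FEx 13 (FEx 14 (FEx 15 (FAnd (F\<Phi> 10 13 14) (FAnd (FPairMem 13 15 i) (FPair 12 15 14))))))))
     (FAll 13 (FAll 14 (FImp (F\<Phi> 10 13 14) (FEx 15 (FPairMem 13 15 i))))))))"

lemma sat_FAttempt [simp]:
  assumes "assignment M s" "s 2 = c" "i < 10"
  shows "sat M s (FAttempt i) \<longleftrightarrow> attempt (s i)"
  using assms unfolding FAttempt_def attempt_def by simp

text \<open>The attempt with least domain containing \<open>y\<close>. Its uniqueness is what makes the union of
  attempts in the inductive step available by replacement, without an appeal to collection.\<close>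

definition least_attempt :: "hset \<Rightarrow> hset \<Rightarrow> bool" where
  "least_attempt y g \<longleftrightarrow> attempt g \<and> (\<exists>b\<in>M. kpair y b \<in> elts g) \<and>
     (\<forall>g'\<in>M. attempt g' \<and> (\<exists>b\<in>M. kpair y b \<in> elts g') \<longrightarrow> (\<forall>z\<in>M. z \<in> elts g \<longrightarrow> z \<in> elts g'))"

definition FLeastAttempt :: "nat \<Rightarrow> nat \<Rightarrow> fm" where
  "FLeastAttempt y g = FAnd (FAttempt g) (FAnd (FEx 10 (FPairMem y 10 g))
     (FAll 5 (FImp (FAnd (FAttempt 5) (FEx 10 (FPairMem y 10 5)))
        (FAll 10 (FImp (FMem 10 g) (FMem 10 5))))))"

lemma sat_FLeastAttempt [simp]:
  assumes "assignment M s" "s 2 = c" "g < 5" "y \<noteq> 5" "y \<noteq> 10"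
  shows "sat M s (FLeastAttempt y g) \<longleftrightarrow> least_attempt (s y) (s g)"
  using assms unfolding FLeastAttempt_def least_attempt_def by simp

lemma attempt_value:
  assumes "attempt g" "g \<in> M" "kpair a b \<in> elts g"
  shows "b = F a"
  using assms(3)
proof (induction a arbitrary: b rule: wf_induct[OF wf_mem_trancl])
  case (1 a)
  then have abM: "a \<in> M" "b \<in> M" using kpair_memD assms(2) by blast+
  have att: "\<forall>w\<in>M. w \<in> elts b \<longleftrightarrow>
        (\<exists>y\<in>M. \<exists>q\<in>M. \<exists>b'\<in>M. \<Phi> a y q \<and> kpair y b' \<in> elts g \<and> w = kpair b' q)"
    "\<forall>y\<in>M. \<forall>q\<in>M. \<Phi> a y q \<longrightarrow> (\<exists>b'\<in>M. kpair y b' \<in> elts g)"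
    using assms(1) 1(2) abM unfolding attempt_def by blast+
  have IH: "b' = F y" if "\<Phi> a y q" "kpair y b' \<in> elts g" for y q b'
    using 1(1) below that by blast
  have "elts b = {kpair (F y) q | y q. \<Phi> a y q}"
  proof (intro equalityI subsetI)
    fix w assume w: "w \<in> elts b"
    then have "w \<in> M" using abM transM by blast
    with w att(1) IH show "w \<in> {kpair (F y) q | y q. \<Phi> a y q}" by blast
  next
    fix w assume "w \<in> {kpair (F y) q | y q. \<Phi> a y q}"
    then obtain y q where yq: "w = kpair (F y) q" "\<Phi> a y q" by blast
    then have "y \<in> M" "q \<in> M" using \<Phi>_in_M abM by blast+
    moreover from this obtain b' where "b' \<in> M" "kpair y b' \<in> elts g" using att(2) yq by blast
    moreover from this have "b' = F y" using IH yq by blast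
    ultimately show "w \<in> elts b" using att(1) yq by (metis kpair_in_M)
  qed
  then show ?case using abM by (simp add: hset_eq_iff elts_F)
qed

lemma least_attempt_unique:
  assumes "least_attempt y g" "least_attempt y g'" "g \<in> M" "g' \<in> M"
  shows "g = g'"
proof -
  have "\<forall>z\<in>M. z \<in> elts g \<longleftrightarrow> z \<in> elts g'"
    using assms unfolding least_attempt_def by blast
  then show ?thesis
    using eqI_in_M[of g "elts g'"] assms elts_subset_M[of g'] by simp
qed

text \<open>Both claims go through one induction: the least attempts at the predecessors of
  \<open>x\<close> are glued to \<open>U\<close>, from which \<open>F x\<close> is computed, and
  adding the pair of \<open>x\<close> and \<open>F x\<close> to \<open>U\<close> gives the least
  attempt at \<open>x\<close>.\<close>

lemma ex_least_attempt:
  assumes "x \<in> M"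
  shows "F x \<in> M \<and> (\<exists>g\<in>M. least_attempt x g)"
  using assms
proof (induction x rule: wf_induct[OF wf_mem_trancl])
  case (1 x)
  then have x: "x \<in> M" by simp
  define G where "G y = (THE g. g \<in> M \<and> least_attempt y g)" for y
  have IH: "F y \<in> M" "\<exists>g\<in>M. least_attempt y g" if "\<Phi> x y q" for y q
    using 1(1) below[OF that] \<Phi>_in_M[OF that x] by auto
  have G_eq: "G y = g" if "g \<in> M" "least_attempt y g" for y g
    unfolding G_def using that least_attempt_unique by blast
  have G: "G y \<in> M" "least_attempt y (G y)" if "\<Phi> x y q" for y q
    using IH(2)[OF that] G_eq by auto
  define fst' where "fst' z = (THE y. \<exists>q. z = kpair y q)" for z
  have fst' [simp]: "fst' (kpair y q) = y" for y q
    unfolding fst'_def by (rule the_equality) auto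
  define U where "U = mkset (\<Union>(elts ` ((\<lambda>z. G (fst' z)) ` elts (support x))))"
  have supp: "z \<in> elts (support x) \<longleftrightarrow> (\<exists>y q. z = kpair y q \<and> \<Phi> x y q)" for z
    using elts_support[OF x] by auto
  \<comment> \<open>\<open>G\<close> is definable by \<open>FLeastAttempt\<close> because least
    attempts are unique; this is the functionality that replacement asks for.\<close>
  have "mkset ((\<lambda>z. G (fst' z)) ` elts (support x)) \<in> M"
  proof (rule replacement_in_M[OF support_in_M[OF x], of "\<lambda>_. c"
        _ "FEx 20 (FEx 21 (FAnd (FPair 0 20 21) (FLeastAttempt 20 1)))"])
    fix z g assume z: "z \<in> M" "z \<in> elts (support x)" and g: "g \<in> M"
    then obtain y q where yq: "z = kpair y q" "\<Phi> x y q" using supp by blast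
    with z have yqM: "y \<in> M" "q \<in> M" using kpair_in_M_iff by auto
    have "sat M ((\<lambda>_. c)(0 := z, 1 := g)) (FEx 20 (FEx 21 (FAnd (FPair 0 20 21) (FLeastAttempt 20 1))))
      \<longleftrightarrow> least_attempt y g"
      using z g param_in_M yqM by (simp add: yq)
    also have "\<dots> \<longleftrightarrow> g = G (fst' z)" using G_eq[OF g] G[OF yq(2)] yq by auto
    finally show "sat M ((\<lambda>_. c)(0 := z, 1 := g))
       (FEx 20 (FEx 21 (FAnd (FPair 0 20 21) (FLeastAttempt 20 1)))) \<longleftrightarrow> g = G (fst' z)" .
  qed (use param_in_M G supp in auto)
  from Union_in_M[OF this] have UM: "U \<in> M" by (simp add: U_def)
  have U: "z \<in> elts U \<longleftrightarrow> (\<exists>y q. \<Phi> x y q \<and> z \<in> elts (G y))" for z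
  proof -
    have "elts U = \<Union>(elts ` ((\<lambda>z. G (fst' z)) ` elts (support x)))"
      unfolding U_def by (rule elts_mkset) simp
    then have "z \<in> elts U \<longleftrightarrow> (\<exists>w. w \<in> elts (support x) \<and> z \<in> elts (G (fst' w)))"
      by (simp only: UN_iff image_iff) blast
    also have "\<dots> \<longleftrightarrow> (\<exists>w. (\<exists>y q. w = kpair y q \<and> \<Phi> x y q \<and> z \<in> elts (G y)))"
      unfolding supp by (metis fst')
    finally show ?thesis by blast
  qed
  have U_val: "b = F a" if "kpair a b \<in> elts U" for a b
    using that U G attempt_value unfolding least_attempt_def by blast
  have U_dom: "kpair y (F y) \<in> elts U" if "\<Phi> x y q" for y q
    using G[OF that] U attempt_value that unfolding least_attempt_def by metis
  \<comment> \<open>No formula for \<open>F\<close> is available yet, so its values at predecessors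
    are read off \<open>U\<close>, which occupies slot 2 here.\<close>
  have "mkset ((\<lambda>z. kpair (F (fst' z)) (THE q. \<exists>y. z = kpair y q)) ` elts (support x)) \<in> M"
  proof (rule replacement_in_M[OF support_in_M[OF x], of "\<lambda>_. U"
        _ "FEx 20 (FEx 21 (FEx 22 (FAnd (FPair 0 20 21) (FAnd (FPairMem 20 22 2) (FPair 1 22 21)))))"])
    fix z w assume z: "z \<in> M" "z \<in> elts (support x)" and w: "w \<in> M"
    then obtain y q where yq: "z = kpair y q" "\<Phi> x y q" using supp by blast
    with z have yqM: "y \<in> M" "q \<in> M" using kpair_in_M_iff by auto
    have "sat M ((\<lambda>_. U)(0 := z, 1 := w)) (FEx 20 (FEx 21 (FEx 22 (FAnd (FPair 0 20 21) (FAnd (FPairMem 20 22 2) (FPair 1 22 21))))))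
      \<longleftrightarrow> (\<exists>b\<in>M. kpair y b \<in> elts U \<and> w = kpair b q)"
      using z w UM yqM by (auto simp: yq)
    also have "\<dots> \<longleftrightarrow> w = kpair (F y) q"
      using U_val U_dom[OF yq(2)] IH(1)[OF yq(2)] by blast
    finally show "sat M ((\<lambda>_. U)(0 := z, 1 := w)) (FEx 20 (FEx 21 (FEx 22 (FAnd (FPair 0 20 21) (FAnd (FPairMem 20 22 2) (FPair 1 22 21))))))
      \<longleftrightarrow> w = kpair (F (fst' z)) (THE q. \<exists>y. z = kpair y q)" by (simp add: yq)
  qed (use UM IH supp \<Phi>_in_M x in auto)
  also have "(\<lambda>z. kpair (F (fst' z)) (THE q. \<exists>y. z = kpair y q)) ` elts (support x) = elts (F x)"
    unfolding elts_F[OF x] using supp by (force simp: image_iff)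
  finally have Fx: "F x \<in> M" by simp
  define g where "g = mkset (elts U \<union> elts (mkset {kpair x (F x)}))"
  have gM: "g \<in> M" unfolding g_def using UM x Fx by (intro Un_in_M) auto
  have g: "z \<in> elts g \<longleftrightarrow> z \<in> elts U \<or> z = kpair x (F x)" for z
    by (auto simp: g_def)
  have att_g: "attempt g"
    unfolding attempt_def
  proof (intro ballI impI)
    fix a b assume ab: "a \<in> M" "b \<in> M" "kpair a b \<in> elts g"
    then have b: "b = F a" using g U_val by auto
    \<comment> \<open>A point other than \<open>x\<close> comes from some \<open>G y'\<close>, whose
      domain is already closed under predecessors.\<close>
    have dom: "kpair y (F y) \<in> elts g" if ayq: "\<Phi> a y q" for y q
    proof (cases "a = x")
      case True
      then show ?thesis using U_dom ayq g by blast
    next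
      case False
      then have "kpair a b \<in> elts U" using ab g by auto
      then obtain y' q' where y': "\<Phi> x y' q'" "kpair a b \<in> elts (G y')" using U by blast
      then have "\<exists>b'\<in>M. kpair y b' \<in> elts (G y')"
        using G(2)[OF y'(1)] ab \<Phi>_in_M[OF ayq] ayq unfolding least_attempt_def attempt_def by blast
      then show ?thesis using U_val U g y' by metis
    qed
    have val: "b' = F y" if "kpair y b' \<in> elts g" for y b'
      using that g U_val by auto
    have FM: "F y \<in> M" if "\<Phi> a y q" for y q
      using kpair_memD[OF dom[OF that] gM] by simp
    have "elts b = {kpair (F y) q | y q. \<Phi> a y q}" using elts_F ab b by simp
    then show "(\<forall>w\<in>M. w \<in> elts b \<longleftrightarrow>
        (\<exists>y\<in>M. \<exists>q\<in>M. \<exists>b'\<in>M. \<Phi> a y q \<and> kpair y b' \<in> elts g \<and> w = kpair b' q)) \<and>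
      (\<forall>y\<in>M. \<forall>q\<in>M. \<Phi> a y q \<longrightarrow> (\<exists>b'\<in>M. kpair y b' \<in> elts g))"
      using dom val FM \<Phi>_in_M ab(1) by simp blast
  qed
  \<comment> \<open>An attempt defined at \<open>x\<close> takes the value \<open>F x\<close> there
    and is defined at every predecessor \<open>y\<close>, so it includes each least attempt
    \<open>G y\<close> and hence all of \<open>g\<close>.\<close>
  have "least_attempt x g"
    unfolding least_attempt_def
  proof (intro conjI ballI impI att_g)
    show "\<exists>b\<in>M. kpair x b \<in> elts g" using Fx g by blast
    fix g' z assume g': "g' \<in> M" "attempt g' \<and> (\<exists>b\<in>M. kpair x b \<in> elts g')" and z: "z \<in> elts g" "z \<in> M"
    then obtain b where b: "kpair x b \<in> elts g'" "b \<in> M" by blast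
    moreover from this have "b = F x" using attempt_value[of g' x b] g' by simp
    ultimately have xg': "kpair x (F x) \<in> elts g'" by simp
    show "z \<in> elts g'"
    proof (cases "z = kpair x (F x)")
      case False
      then obtain y q where y: "\<Phi> x y q" "z \<in> elts (G y)" using z g U by blast
      have "attempt g'" using g' by simp
      from this[unfolded attempt_def, THEN bspec, THEN bspec, THEN mp, THEN conjunct2, OF x Fx xg']
      have "\<exists>b'\<in>M. kpair y b' \<in> elts g'" using \<Phi>_in_M[OF y(1) x] y(1) by blast
      moreover have "attempt g' \<and> (\<exists>b\<in>M. kpair y b \<in> elts g') \<longrightarrow> (\<forall>z\<in>M. z \<in> elts (G y) \<longrightarrow> z \<in> elts g')"
        using G(2)[OF y(1)] g'(1) by (simp add: least_attempt_def)
      ultimately show ?thesis using g' y(2) z by simp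
    qed (use xg' in simp)
  qed
  then show ?case using Fx gM by blast
qed

lemma F_in_M: "x \<in> M \<Longrightarrow> F x \<in> M"
  using ex_least_attempt by blast

end

section \<open>Renaming of conditions and canonical names as recursions in the model\<close>

text \<open>For a relation this is the field: two unions undo a Kuratowski pair. It serves as the
  bound demanded by \<open>bounded\<close>.\<close>

definition field_set :: "hset \<Rightarrow> hset" where
  "field_set x = mkset (\<Union>(elts ` elts (mkset (\<Union>(elts ` elts x)))))"

lemma kpair_in_field_set:
  assumes "kpair y p \<in> elts x"
  shows "y \<in> elts (field_set x)" "p \<in> elts (field_set x)"
proof -
  have "mkset {y, p} \<in> elts (kpair y p)" by simp
  with assms have "mkset {y, p} \<in> \<Union>(elts ` elts x)" by blast
  then have "elts (mkset {y, p}) \<subseteq> \<Union>(elts ` \<Union>(elts ` elts x))" by blast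
  then show "y \<in> elts (field_set x)" "p \<in> elts (field_set x)" by (simp_all add: field_set_def)
qed

lemma kpair_in_fun_graph [simp]: "kpair x y \<in> elts (fun_graph A f) \<longleftrightarrow> x \<in> elts A \<and> y = f x"
  by (auto simp: fun_graph_def)

text \<open>The recursion \<open>\<tau> \<mapsto> {(\<sigma>\<^sup>*, q) | (\<sigma>, p) \<in> \<tau>, (p, q) \<in> c}\<close> renaming the conditions in a name.\<close>

definition rename_step :: "hset \<Rightarrow> hset \<Rightarrow> hset \<Rightarrow> hset \<Rightarrow> bool" where
  "rename_step c x y q \<longleftrightarrow> (\<exists>p. kpair y p \<in> elts x \<and> kpair p q \<in> elts c)"

text \<open>Three successors make the bound variable at least 3, so it also avoids the parameter
  slot 2.\<close>

definition FRename :: "nat \<Rightarrow> nat \<Rightarrow> nat \<Rightarrow> fm" where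
  "FRename i j k = (let n = Suc (Suc (Suc (i + j + k))) in
     FEx n (FAnd (FPairMem j n i) (FPairMem n k 2)))"

text \<open>Below \<open>c\<close> this recursion builds the canonical names of ground-model sets (with all conditions
  used as labels, because \<open>c\<close> need not have a greatest element), whereas at \<open>c\<close> itself it builds
  the canonical name \<open>{(p\<^sup>\<or>, p) | p \<in> c}\<close> of the generic filter.\<close>

definition check_step :: "hset \<Rightarrow> hset \<Rightarrow> hset \<Rightarrow> hset \<Rightarrow> bool" where
  "check_step c x y q \<longleftrightarrow> y \<in> elts x \<and> (if x = c then q = y else q \<in> elts c)"

definition FCheck :: "nat \<Rightarrow> nat \<Rightarrow> nat \<Rightarrow> fm" where
  "FCheck i j k = FAnd (FMem j i)
     (FOr (FAnd (FEq i 2) (FEq k j)) (FAnd (FNeg (FEq i 2)) (FMem k 2)))"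

context ctm_model
begin

lemma field_set_in_M: "x \<in> M \<Longrightarrow> field_set x \<in> M"
  unfolding field_set_def by (intro Union_in_M)

lemma name_recursion_rename: "c \<in> M \<Longrightarrow> name_recursion M c (rename_step c) FRename"
proof
  assume c: "c \<in> M"
  show "sat M s (FRename i j k) \<longleftrightarrow> rename_step c (s i) (s j) (s k)"
    if s: "assignment M s" "s 2 = c" for s i j k
  proof -
    have "sat M s (FRename i j k) \<longleftrightarrow> (\<exists>p\<in>M. kpair (s j) p \<in> elts (s i) \<and> kpair p (s k) \<in> elts c)"
      using s by (simp add: FRename_def Let_def)
    also have "\<dots> \<longleftrightarrow> rename_step c (s i) (s j) (s k)"
      unfolding rename_step_def using kpair_memD c by blast
    finally show ?thesis .
  qed
  show "(y, x) \<in> mem_rel\<^sup>+" if "rename_step c x y q" for x y q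
    using that kpair_fst_below unfolding rename_step_def by blast
  show "\<exists>a\<in>M. \<exists>b\<in>M. \<forall>y q. rename_step c x y q \<longrightarrow> y \<in> elts a \<and> q \<in> elts b" if "x \<in> M" for x
    using field_set_in_M[OF that] field_set_in_M[OF c] kpair_in_field_set
    unfolding rename_step_def by blast
qed

lemma name_recursion_check: "c \<in> M \<Longrightarrow> name_recursion M c (check_step c) FCheck"
proof
  assume c: "c \<in> M"
  show "sat M s (FCheck i j k) \<longleftrightarrow> check_step c (s i) (s j) (s k)"
    if "assignment M s" "s 2 = c" for s i j k
    using that by (auto simp: FCheck_def check_step_def)
  show "(y, x) \<in> mem_rel\<^sup>+" if "check_step c x y q" for x y q
    using that unfolding check_step_def by blast
  show "\<exists>a\<in>M. \<exists>b\<in>M. \<forall>y q. check_step c x y q \<longrightarrow> y \<in> elts a \<and> q \<in> elts b" if "x \<in> M" for x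
    using that c unfolding check_step_def by (intro bexI[of _ x] bexI[of _ c]) (auto split: if_splits)
qed

text \<open>Applying \<open>e\<close> to all conditions hereditarily inside a name gives a name in
  \<open>M\<close> whose value under the image filter is the old value under \<open>G\<close>. The
  reverse inclusion comes from the inverse of \<open>e\<close> in
  \<open>gen_equiv_image\<close>.\<close>

lemma gen_ext_subset_image:
  assumes inj: "inj_on e (elts P)" and e: "e ` elts P \<subseteq> elts P"
    and graph: "fun_graph P e \<in> M" and G: "G \<subseteq> elts P"
  shows "gen_ext M P G \<subseteq> gen_ext M P (e ` G)"
proof -
  define c where "c = fun_graph P e"
  interpret name_recursion M c "rename_step c" FRename
    using graph by (intro name_recursion_rename) (simp add: c_def)
  have elts_F': "elts (F \<tau>) = {kpair (F \<sigma>) (e p) | \<sigma> p. kpair \<sigma> p \<in> elts \<tau> \<and> p \<in> elts P}"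
    if "\<tau> \<in> M" for \<tau>
  proof -
    have "rename_step c \<tau> \<sigma> q \<longleftrightarrow> (\<exists>p. kpair \<sigma> p \<in> elts \<tau> \<and> p \<in> elts P \<and> q = e p)" for \<sigma> q
      by (simp add: rename_step_def c_def)
    then show ?thesis unfolding elts_F[OF that] by (auto simp del: kpair_inject)
  qed
  have rename: "is_name P (F \<tau>) \<and> val (e ` G) (F \<tau>) = val G \<tau>" if "is_name P \<tau>" "\<tau> \<in> M" for \<tau>
    using that
  proof (induction \<tau> rule: is_name.induct)
    case (1 \<tau>)
    have IH: "is_name P (F \<sigma>) \<and> val (e ` G) (F \<sigma>) = val G \<sigma>" if "kpair \<sigma> p \<in> elts \<tau>" for \<sigma> p
    proof -
      have "\<sigma> \<in> M" using kpair_memD that 1(2) by blast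
      then show ?thesis using 1(1)[OF that] by auto
    qed
    have name: "is_name P (F \<tau>)"
    proof (rule is_name.intros)
      fix x assume "x \<in> elts (F \<tau>)"
      then obtain \<sigma> p where "x = kpair (F \<sigma>) (e p)" "kpair \<sigma> p \<in> elts \<tau>" "p \<in> elts P"
        using elts_F'[OF 1(2)] by blast
      then show "\<exists>\<sigma> p. x = kpair \<sigma> p \<and> p \<in> elts P \<and> is_name P \<sigma>"
        using IH e by blast
    qed
    have "{\<rho>. \<exists>q\<in>e ` G. kpair \<rho> q \<in> elts (F \<tau>)} = F ` {\<sigma>. \<exists>p\<in>G. kpair \<sigma> p \<in> elts \<tau>}"
    proof (intro equalityI subsetI)
      fix \<rho> assume "\<rho> \<in> {\<rho>. \<exists>q\<in>e ` G. kpair \<rho> q \<in> elts (F \<tau>)}"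
      then obtain p \<sigma> p' where p: "p \<in> G" "\<rho> = F \<sigma>" "e p = e p'" "kpair \<sigma> p' \<in> elts \<tau>" "p' \<in> elts P"
        using elts_F'[OF 1(2)] by auto
      \<comment> \<open>Without injectivity a pair labelled by a condition outside \<open>G\<close>
        could become active after renaming.\<close>
      then have "p = p'" using inj G by (auto dest: inj_onD)
      with p show "\<rho> \<in> F ` {\<sigma>. \<exists>p\<in>G. kpair \<sigma> p \<in> elts \<tau>}" by blast
    next
      fix \<rho> assume "\<rho> \<in> F ` {\<sigma>. \<exists>p\<in>G. kpair \<sigma> p \<in> elts \<tau>}"
      then obtain \<sigma> p where "p \<in> G" "\<rho> = F \<sigma>" "kpair \<sigma> p \<in> elts \<tau>" by blast
      then show "\<rho> \<in> {\<rho>. \<exists>q\<in>e ` G. kpair \<rho> q \<in> elts (F \<tau>)}"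
        using elts_F'[OF 1(2)] G by blast
    qed
    then have "elts (val (e ` G) (F \<tau>)) = (\<lambda>\<sigma>. val (e ` G) (F \<sigma>)) ` {\<sigma>. \<exists>p\<in>G. kpair \<sigma> p \<in> elts \<tau>}"
      by (simp add: elts_val image_image)
    also have "\<dots> = elts (val G \<tau>)"
      unfolding elts_val using IH by (intro image_cong) auto
    finally show ?case using name by (simp add: hset_eq_iff)
  qed
  show ?thesis
  proof
    fix x assume "x \<in> gen_ext M P G"
    then obtain \<tau> where \<tau>: "x = val G \<tau>" "\<tau> \<in> M" "is_name P \<tau>" by (auto simp: gen_ext_def)
    then have "x = val (e ` G) (F \<tau>)" "F \<tau> \<in> M" "is_name P (F \<tau>)" using rename F_in_M by auto
    then show "x \<in> gen_ext M P (e ` G)" unfolding gen_ext_def by blast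
  qed
qed

lemma inverse_graph_in_M:
  assumes P: "P \<in> M" and bij: "bij_betw e (elts P) (elts P)" and graph: "fun_graph P e \<in> M"
  shows "fun_graph P (inv_into (elts P) e) \<in> M"
proof -
  have "mkset {kpair y q | y q. y \<in> elts P \<and> q \<in> elts P \<and> y = e q} \<in> M"
    by (rule relation_in_M[OF P P, where s = "\<lambda>_. fun_graph P e" and \<phi> = "FPairMem 21 20 2"])
      (use graph bij in \<open>auto simp: bij_betw_def\<close>)
  also have "{kpair y q | y q. y \<in> elts P \<and> q \<in> elts P \<and> y = e q} =
      (\<lambda>x. kpair x (inv_into (elts P) e x)) ` elts P"
    using bij by (auto simp: bij_betw_def inv_into_into f_inv_into_f image_iff)
  finally show ?thesis by (simp add: fun_graph_def)
qed

lemma gen_equiv_image: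
  assumes P: "P \<in> M" and bij: "bij_betw e (elts P) (elts P)" and graph: "fun_graph P e \<in> M"
    and G: "G \<subseteq> elts P"
  shows "gen_equiv M P G (e ` G)"
proof -
  let ?i = "inv_into (elts P) e"
  have i: "bij_betw ?i (elts P) (elts P)" using bij by (rule bij_betw_inv_into)
  have eG: "e ` G \<subseteq> elts P" using bij G by (auto simp: bij_betw_def)
  have "?i ` e ` G = G" using bij G by (simp add: bij_betw_def inv_into_image_cancel)
  moreover have "gen_ext M P (e ` G) \<subseteq> gen_ext M P (?i ` e ` G)"
    using i by (intro gen_ext_subset_image eG inverse_graph_in_M[OF P bij graph])
      (auto simp: bij_betw_def)
  moreover have "gen_ext M P G \<subseteq> gen_ext M P (e ` G)"
    using bij by (intro gen_ext_subset_image graph G) (auto simp: bij_betw_def)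
  ultimately show ?thesis by (auto simp: gen_equiv_def)
qed

text \<open>The name is the value at \<open>P\<close> of the \<open>check_step\<close> recursion.
  Since the canonical names below \<open>P\<close> carry all conditions as labels, any nonempty
  \<open>G\<close> evaluates them correctly.\<close>

lemma generic_name:
  assumes P: "P \<in> M"
  obtains \<gamma> where "\<And>G. G \<subseteq> elts P \<Longrightarrow> G \<noteq> {} \<Longrightarrow> val G \<gamma> \<in> gen_ext M P G \<and> elts (val G \<gamma>) = G"
proof -
  interpret name_recursion M P "check_step P" FCheck
    using P by (rule name_recursion_check)
  have F_below: "elts (F x) = {kpair (F y) q | y q. y \<in> elts x \<and> q \<in> elts P}" if "x \<in> M" "x \<noteq> P" for x
    unfolding elts_F[OF that(1)] check_step_def using that(2) by auto
  have F_P: "elts (F P) = {kpair (F p) p | p. p \<in> elts P}"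
    unfolding elts_F[OF P] check_step_def by auto
  \<comment> \<open>The induction stays strictly below \<open>P\<close>, where well-foundedness
    excludes the exceptional clause of \<open>check_step\<close>.\<close>
  have check: "is_name P (F x) \<and> (\<forall>G. G \<subseteq> elts P \<longrightarrow> G \<noteq> {} \<longrightarrow> val G (F x) = x)"
    if "(x, P) \<in> mem_rel\<^sup>+" for x
    using that
  proof (induction x rule: wf_induct[OF wf_elts])
    case (1 x)
    have xM: "x \<in> M" using 1(2) P mem_trancl_in_M by blast
    have xP: "x \<noteq> P" using 1(2) wf_mem_trancl by auto
    have IH: "is_name P (F y)" "\<And>G. G \<subseteq> elts P \<Longrightarrow> G \<noteq> {} \<Longrightarrow> val G (F y) = y" if "y \<in> elts x" for y
      using 1 that trancl_into_trancl2[of y x mem_rel P] by auto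
    have "is_name P (F x)"
      by (rule is_name.intros) (use F_below[OF xM xP] IH in blast)
    moreover have "val G (F x) = x" if G: "G \<subseteq> elts P" "G \<noteq> {}" for G
    proof -
      have "{\<sigma>. \<exists>p\<in>G. kpair \<sigma> p \<in> elts (F x)} = F ` elts x"
      proof -
        have "kpair \<sigma> p \<in> elts (F x) \<longleftrightarrow> (\<exists>y\<in>elts x. \<sigma> = F y \<and> p \<in> elts P)" for \<sigma> p
          by (auto simp: F_below[OF xM xP])
        then show ?thesis using G by blast
      qed
      then have "elts (val G (F x)) = (\<lambda>y. val G (F y)) ` elts x" by (simp add: elts_val image_image)
      also have "\<dots> = elts x" using IH(2)[OF _ G] by simp
      finally show ?thesis by (simp add: hset_eq_iff)
    qed
    ultimately show ?case by blast
  qed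
  show ?thesis
  proof (rule that[of "F P"])
    fix G assume G: "G \<subseteq> elts P" "G \<noteq> {}"
    have "is_name P (F P)"
      by (rule is_name.intros) (use F_P check in blast)
    then have in_ext: "val G (F P) \<in> gen_ext M P G" using F_in_M[OF P] by (auto simp: gen_ext_def)
    have "{\<sigma>. \<exists>p\<in>G. kpair \<sigma> p \<in> elts (F P)} = F ` G"
      using F_P G by auto
    then have "elts (val G (F P)) = (\<lambda>p. val G (F p)) ` G" by (simp add: elts_val image_image)
    also have "\<dots> = (\<lambda>p. p) ` G"
      using G check by (intro image_cong) auto
    finally show "val G (F P) \<in> gen_ext M P G \<and> elts (val G (F P)) = G" using in_ext by simp
  qed
qed

lemma countable_gen_ext: "countable (gen_ext M P G)"
proof -
  have "gen_ext M P G \<subseteq> val G ` M" by (auto simp: gen_ext_def)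
  then show ?thesis by (rule countable_subset) (simp add: countable_M)
qed

lemma countable_gen_equiv_class:
  assumes P: "P \<in> M"
  shows "countable {H \<in> Gen M P R. gen_equiv M P G H}"
proof -
  obtain \<gamma> where \<gamma>: "\<And>G. G \<subseteq> elts P \<Longrightarrow> G \<noteq> {} \<Longrightarrow> val G \<gamma> \<in> gen_ext M P G \<and> elts (val G \<gamma>) = G"
    using generic_name[OF P] by blast
  have "{H \<in> Gen M P R. gen_equiv M P G H} \<subseteq> elts ` gen_ext M P G"
  proof
    fix H assume "H \<in> {H \<in> Gen M P R. gen_equiv M P G H}"
    then have "H \<subseteq> elts P" "H \<noteq> {}" "gen_ext M P H = gen_ext M P G"
      by (auto simp: Gen_def filter_in_order_def gen_equiv_def)
    then show "H \<in> elts ` gen_ext M P G" using \<gamma>[of H] by (metis imageI)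
  qed
  then show ?thesis by (rule countable_subset) (simp add: countable_gen_ext)
qed

lemma Gen_image:
  assumes P: "P \<in> M" and G: "G \<in> Gen M P R"
    and e: "automorphism P R e" and graph: "fun_graph P e \<in> M"
  shows "e ` G \<in> Gen M P R"
proof -
  have bij: "bij_betw e (elts P) (elts P)"
    and mono: "\<And>p q. p \<in> elts P \<Longrightarrow> q \<in> elts P \<Longrightarrow> (p, q) \<in> rel_of R \<longleftrightarrow> (e p, e q) \<in> rel_of R"
    using e by (auto simp: automorphism_def)
  have surj: "\<exists>p\<in>elts P. q = e p" if "q \<in> elts P" for q
    using bij that by (auto simp: bij_betw_def)
  have into: "e p \<in> elts P" if "p \<in> elts P" for p
    using bij that by (auto simp: bij_betw_def)
  have F: "filter_in_order P R G" using G by (simp add: Gen_def)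
  then have GP: "G \<subseteq> elts P" by (simp add: filter_in_order_def)
  have "filter_in_order P R (e ` G)"
    unfolding filter_in_order_def
  proof (intro conjI ballI impI)
    show "e ` G \<subseteq> elts P" using GP into by blast
    show "e ` G \<noteq> {}" using F by (simp add: filter_in_order_def)
    fix p assume p: "p \<in> e ` G"
    then obtain p' where p': "p' \<in> G" "p = e p'" by blast
    show "q \<in> e ` G" if q: "q \<in> elts P" "(p, q) \<in> rel_of R" for q
    proof -
      obtain q' where q': "q' \<in> elts P" "q = e q'" using surj q by blast
      then have "(p', q') \<in> rel_of R" using mono p' q GP by blast
      then show ?thesis using F p' q' by (auto simp: filter_in_order_def)
    qed
    show "\<exists>r\<in>e ` G. (r, p) \<in> rel_of R \<and> (r, q) \<in> rel_of R" if q: "q \<in> e ` G" for q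
    proof -
      obtain q' where q': "q' \<in> G" "q = e q'" using q by blast
      then obtain r where "r \<in> G" "(r, p') \<in> rel_of R" "(r, q') \<in> rel_of R"
        using F p' unfolding filter_in_order_def by blast
      then show ?thesis using mono p' q' GP by blast
    qed
  qed
  moreover have "e ` G \<inter> elts D \<noteq> {}" if D: "D \<in> M" "dense_in_order P R (elts D)" for D
  proof -
    \<comment> \<open>Genericity is applied to the preimage of \<open>D\<close>, which lies in
      \<open>M\<close> because the graph of \<open>e\<close> does.\<close>
    define E where "E = mkset {p \<in> elts P. e p \<in> elts D}"
    have "E \<in> M" unfolding E_def
      by (rule separation_in_M[OF P, of "(\<lambda>_. D)(3 := fun_graph P e)" "FEx 20 (FAnd (FPairMem 0 20 3) (FMem 20 4))"])
        (use D graph transM in auto)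
    have eltsE: "elts E = {p \<in> elts P. e p \<in> elts D}"
      unfolding E_def by (rule elts_mkset, rule countable_subset[OF _ countable_elts[of P]]) auto
    have "dense_in_order P R (elts E)"
      unfolding dense_in_order_def eltsE
    proof (intro conjI ballI)
      fix p assume p: "p \<in> elts P"
      then obtain d where d: "d \<in> elts D" "(d, e p) \<in> rel_of R" "d \<in> elts P"
        using D(2) into[OF p] unfolding dense_in_order_def by blast
      obtain d' where "d' \<in> elts P" "d = e d'" using surj d by blast
      then show "\<exists>d\<in>{p \<in> elts P. e p \<in> elts D}. (d, p) \<in> rel_of R"
        using d p mono by auto
    qed auto
    then have "G \<inter> elts E \<noteq> {}" using G \<open>E \<in> M\<close> by (auto simp: Gen_def)
    then show ?thesis using eltsE by blast
  qed
  ultimately show ?thesis by (simp add: Gen_def)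
qed

end

section \<open>Category in the space of generic filters\<close>

locale forcing = ctm_model +
  fixes P R :: hset
  assumes partial_order: "partial_order_in M P R"
begin

abbreviation le :: "hset \<Rightarrow> hset \<Rightarrow> bool" (infix \<open>\<preceq>\<close> 50) where
  "p \<preceq> q \<equiv> (p, q) \<in> rel_of R"

lemma P_in_M: "P \<in> M"
  using partial_order by (simp add: partial_order_in_def)

lemma po: "partial_order_on (elts P) (rel_of R)"
  using partial_order by (simp add: partial_order_in_def)

lemma le_refl: "p \<in> elts P \<Longrightarrow> p \<preceq> p"
  using partial_order_onD(1)[OF po] by (simp add: refl_on_def)

lemma le_trans: "p \<preceq> q \<Longrightarrow> q \<preceq> r \<Longrightarrow> p \<preceq> r"
  using partial_order_onD(2)[OF po] by (rule transD)

lemma le_in_P: "p \<preceq> q \<Longrightarrow> p \<in> elts P \<and> q \<in> elts P"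
  using partial_order_onD(4)[OF po] by blast

definition dense_family :: "hset set set \<Rightarrow> bool" where
  "dense_family \<D> \<longleftrightarrow> countable \<D> \<and> (\<forall>D\<in>\<D>. dense_in_order P R D)"

definition Gen_for :: "hset set set \<Rightarrow> hset set set" where
  "Gen_for \<D> = {G \<in> Gen M P R. \<forall>D\<in>\<D>. G \<inter> D \<noteq> {}}"

lemma Gen_forD: "G \<in> Gen_for \<D> \<Longrightarrow> G \<in> Gen M P R"
  by (simp add: Gen_for_def)

lemma Gen_for_Un: "Gen_for (\<D> \<union> \<E>) = Gen_for \<D> \<inter> Gen_for \<E>"
  by (auto simp: Gen_for_def)

lemma Gen_for_UN: "Gen_for (\<Union>i\<in>I. \<D> i) = {G \<in> Gen M P R. \<forall>i\<in>I. G \<in> Gen_for (\<D> i)}"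
  by (auto simp: Gen_for_def)

lemma dense_family_Un: "dense_family \<D> \<Longrightarrow> dense_family \<E> \<Longrightarrow> dense_family (\<D> \<union> \<E>)"
  by (auto simp: dense_family_def)

lemma dense_family_UN:
  "countable I \<Longrightarrow> (\<And>i. i \<in> I \<Longrightarrow> dense_family (\<D> i)) \<Longrightarrow> dense_family (\<Union>i\<in>I. \<D> i)"
  by (auto simp: dense_family_def)

lemma Gen_props:
  assumes "G \<in> Gen M P R"
  shows "G \<subseteq> elts P" "p \<in> G \<Longrightarrow> p \<preceq> q \<Longrightarrow> q \<in> G"
    "p \<in> G \<Longrightarrow> q \<in> G \<Longrightarrow> \<exists>r\<in>G. r \<preceq> p \<and> r \<preceq> q"
  using assms le_in_P unfolding Gen_def filter_in_order_def by blast+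

text \<open>Since \<open>M\<close> is countable, its dense sets can be adjoined to
  \<open>\<D>\<close>; one descending sequence below \<open>p\<close> then meets all of
  them.\<close>

lemma ex_Gen_for:
  assumes \<D>: "dense_family \<D>" and p: "p \<in> elts P"
  shows "\<exists>G\<in>Gen_for \<D>. p \<in> G"
proof -
  \<comment> \<open>Inserting \<open>elts P\<close> keeps the family nonempty, as the enumeration by
    \<open>from_nat_into\<close> requires.\<close>
  define \<E> where "\<E> = insert (elts P) (\<D> \<union> {elts D | D. D \<in> M \<and> dense_in_order P R (elts D)})"
  have "{elts D | D. D \<in> M \<and> dense_in_order P R (elts D)} \<subseteq> elts ` M" by blast
  then have "countable {elts D | D. D \<in> M \<and> dense_in_order P R (elts D)}"
    by (rule countable_subset) (simp add: countable_M)
  then have cE: "countable \<E>" using \<D> by (simp add: \<E>_def dense_family_def)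
  have dense_P: "dense_in_order P R (elts P)"
    unfolding dense_in_order_def using le_refl by blast
  have dE: "dense_in_order P R D" if "D \<in> \<E>" for D
    using that \<D> dense_P by (auto simp: \<E>_def dense_family_def)
  define D where "D = from_nat_into \<E>"
  have neE: "\<E> \<noteq> {}" by (simp add: \<E>_def)
  have D: "dense_in_order P R (D n)" for n
    using dE from_nat_into[OF neE] by (simp add: D_def)
  have "\<exists>f. \<forall>n. (f n \<in> elts P \<and> (n = 0 \<longrightarrow> f n = p)) \<and> (f (Suc n) \<in> D n \<and> f (Suc n) \<preceq> f n)"
  proof (rule dependent_nat_choice)
    fix q and n :: nat assume "q \<in> elts P \<and> (n = 0 \<longrightarrow> q = p)"
    then obtain d where "d \<in> D n" "d \<preceq> q" using D[of n] unfolding dense_in_order_def by blast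
    then show "\<exists>d. (d \<in> elts P \<and> (Suc n = 0 \<longrightarrow> d = p)) \<and> d \<in> D n \<and> d \<preceq> q"
      using le_in_P[of d q] by auto
  qed (use p in blast)
  then obtain f where f: "\<And>n. f n \<in> elts P" "f 0 = p" "\<And>n. f (Suc n) \<in> D n" "\<And>n. f (Suc n) \<preceq> f n"
    by metis
  have anti: "f n \<preceq> f m" if "m \<le> n" for m n
    using that
  proof (induction n rule: dec_induct)
    case base
    then show ?case using f(1) le_refl by simp
  next
    case (step n)
    then show ?case using f(4) le_trans by blast
  qed
  define G where "G = {q. \<exists>n. f n \<preceq> q}"
  have fG: "f n \<in> G" for n using le_refl[OF f(1)] by (auto simp: G_def)
  have "filter_in_order P R G"
    unfolding filter_in_order_def
  proof (intro conjI ballI impI)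
    show "G \<subseteq> elts P" using le_in_P by (auto simp: G_def)
    show "G \<noteq> {}" using fG by blast
    show "q \<in> G" if "p \<in> G" "q \<in> elts P" "p \<preceq> q" for p q
      using that le_trans unfolding G_def by blast
    show "\<exists>r\<in>G. r \<preceq> p \<and> r \<preceq> q" if pq: "p \<in> G" "q \<in> G" for p q
    proof -
      obtain m n where "f m \<preceq> p" "f n \<preceq> q" using pq by (auto simp: G_def)
      then have "f (max m n) \<preceq> p" "f (max m n) \<preceq> q"
        using le_trans[OF anti] max.cobounded1[of m n] max.cobounded2[of n m] by blast+
      then show ?thesis using fG by blast
    qed
  qed
  moreover have meets: "G \<inter> E \<noteq> {}" if E: "E \<in> \<E>" for E
  proof -
    obtain n where "E = D n" using from_nat_into_surj[OF cE E] by (auto simp: D_def)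
    then show ?thesis using f(3)[of n] fG by blast
  qed
  ultimately have "G \<in> Gen_for \<D>"
    by (auto simp: Gen_for_def Gen_def \<E>_def)
  moreover have "p \<in> G" using f(2) fG by metis
  ultimately show ?thesis by blast
qed

text \<open>\<open>forces p A\<close> says that \<open>A\<close> is comeagre in the basic open set of generic filters containing \<open>p\<close>.\<close>

definition forces :: "hset \<Rightarrow> hset set set \<Rightarrow> bool" where
  "forces p A \<longleftrightarrow> (\<exists>\<D>. dense_family \<D> \<and> (\<forall>G\<in>Gen_for \<D>. p \<in> G \<longrightarrow> G \<in> A))"

text \<open>A form of the Baire property. The complement is taken in the whole type, which is
  harmless because \<open>forces\<close> tests generic filters only.\<close>

definition decided :: "hset set set \<Rightarrow> bool" where
  "decided A \<longleftrightarrow> (\<forall>p\<in>elts P. \<exists>q\<in>elts P. q \<preceq> p \<and> (forces q A \<or> forces q (- A)))"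

section \<open>Local comeagreness: consistency, density and countable intersections\<close>

lemma forces_mono: "forces p A \<Longrightarrow> A \<subseteq> B \<Longrightarrow> forces p B"
  unfolding forces_def by blast

lemma forces_consistent:
  assumes "p \<in> elts P" "forces p A" "forces p (- A)"
  shows False
proof -
  obtain \<D> where \<D>: "dense_family \<D>" "\<And>G. G \<in> Gen_for \<D> \<Longrightarrow> p \<in> G \<Longrightarrow> G \<in> A"
    using assms(2) unfolding forces_def by (elim exE conjE) auto
  obtain \<E> where \<E>: "dense_family \<E>" "\<And>G. G \<in> Gen_for \<E> \<Longrightarrow> p \<in> G \<Longrightarrow> G \<notin> A"
    using assms(3) unfolding forces_def by (elim exE conjE) auto
  obtain G where "G \<in> Gen_for (\<D> \<union> \<E>)" "p \<in> G"
    using ex_Gen_for[OF dense_family_Un[OF \<D>(1) \<E>(1)] assms(1)] by (elim bexE)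
  then show False using \<D>(2)[of G] \<E>(2)[of G] by (simp add: Gen_for_Un)
qed

lemma forces_le: "forces p A \<Longrightarrow> q \<preceq> p \<Longrightarrow> forces q A"
  unfolding forces_def using Gen_props(2)[OF Gen_forD] by blast

text \<open>Adding the conditions incompatible with \<open>p\<close> turns density below
  \<open>p\<close> into density. A filter containing \<open>p\<close> can meet the enlarged set only
  inside \<open>A\<close>.\<close>

lemma dense_below_or_incompatible:
  assumes "\<And>q. q \<preceq> p \<Longrightarrow> \<exists>r\<in>A. r \<preceq> q"
  shows "dense_in_order P R {r \<in> elts P. r \<in> A \<or> \<not> compatible P R r p}"
  unfolding dense_in_order_def
proof (intro conjI ballI)
  fix q assume q: "q \<in> elts P"
  show "\<exists>d\<in>{r \<in> elts P. r \<in> A \<or> \<not> compatible P R r p}. d \<preceq> q"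
  proof (cases "compatible P R q p")
    case True
    then obtain r where "r \<preceq> q" "r \<preceq> p" by (auto simp: compatible_def)
    with assms obtain r' where "r' \<in> A" "r' \<preceq> r" by blast
    then show ?thesis using \<open>r \<preceq> q\<close> le_trans le_in_P by blast
  qed (use q le_refl in blast)
qed auto

lemma forces_of_dense_below:
  assumes "\<And>q. q \<preceq> p \<Longrightarrow> \<exists>r. r \<preceq> q \<and> forces r A"
  shows "forces p A"
proof -
  define D where "D = {r \<in> elts P. r \<in> {r. forces r A} \<or> \<not> compatible P R r p}"
  have D: "dense_in_order P R D"
    unfolding D_def using assms by (intro dense_below_or_incompatible) blast
  define \<D> where "\<D> r = (SOME \<D>. dense_family \<D> \<and> (\<forall>G\<in>Gen_for \<D>. r \<in> G \<longrightarrow> G \<in> A))" for r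
  have \<D>: "dense_family (\<D> r) \<and> (\<forall>G\<in>Gen_for (\<D> r). r \<in> G \<longrightarrow> G \<in> A)" if "forces r A" for r
    unfolding \<D>_def using that[unfolded forces_def] by (rule someI_ex)
  \<comment> \<open>There are only countably many conditions, so the witnesses of all those forcing
    \<open>A\<close> can be collected in one countable family.\<close>
  define \<E> where "\<E> = {D} \<union> (\<Union>r\<in>{r \<in> elts P. forces r A}. \<D> r)"
  have "countable {r \<in> elts P. forces r A}" by (rule countable_subset[OF _ countable_elts[of P]]) auto
  then have "dense_family \<E>" unfolding \<E>_def
    using D \<D> by (intro dense_family_Un dense_family_UN) (auto simp: dense_family_def)
  moreover have "G \<in> A" if G: "G \<in> Gen_for \<E>" "p \<in> G" for G
  proof -
    have Gg: "G \<in> Gen M P R" using G Gen_forD by blast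
    obtain r where r: "r \<in> G" "r \<in> D" using G by (auto simp: Gen_for_def \<E>_def)
    have "compatible P R r p" using Gen_props[OF Gg] r(1) G(2) unfolding compatible_def by blast
    then have "forces r A" "r \<in> elts P" using r by (auto simp: D_def)
    then have "G \<in> Gen_for (\<D> r)" using G(1) unfolding \<E>_def Gen_for_Un Gen_for_UN by blast
    then show ?thesis using \<D> \<open>forces r A\<close> r(1) by blast
  qed
  ultimately show ?thesis unfolding forces_def by blast
qed

lemma forces_INT:
  assumes "\<And>n::nat. forces p (A n)"
  shows "forces p (\<Inter>n. A n)"
proof -
  obtain \<D> where \<D>: "\<And>n. dense_family (\<D> n) \<and> (\<forall>G\<in>Gen_for (\<D> n). p \<in> G \<longrightarrow> G \<in> A n)"
    using assms unfolding forces_def by metis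
  then have "dense_family (\<Union>n. \<D> n)" by (intro dense_family_UN) auto
  moreover have "\<forall>G\<in>Gen_for (\<Union>n. \<D> n). p \<in> G \<longrightarrow> G \<in> (\<Inter>n. A n)"
    using \<D> by (auto simp: Gen_for_UN)
  ultimately show ?thesis unfolding forces_def by blast
qed

lemma decided_Compl: "decided A \<Longrightarrow> decided (- A)"
  unfolding decided_def double_complement by blast

text \<open>If no extension of \<open>p\<close> forces any \<open>A n\<close>, then each complement
  is forced densely below \<open>p\<close>, hence by \<open>p\<close>, and countably many families
  combine.\<close>

lemma decided_UN:
  assumes "\<And>n::nat. decided (A n)"
  shows "decided (\<Union>n. A n)"
  unfolding decided_def
proof (intro ballI)
  fix p assume p: "p \<in> elts P"
  show "\<exists>q\<in>elts P. q \<preceq> p \<and> (forces q (\<Union>n. A n) \<or> forces q (- (\<Union>n. A n)))"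
  proof (cases "\<exists>n q. q \<preceq> p \<and> forces q (A n)")
    case True
    then obtain n q where "q \<preceq> p" "forces q (A n)" by blast
    then show ?thesis using forces_mono[of q "A n" "\<Union>n. A n"] le_in_P by blast
  next
    case False
    have "forces p (- A n)" for n
    proof (rule forces_of_dense_below)
      fix q assume q: "q \<preceq> p"
      then obtain r where "r \<preceq> q" "forces r (A n) \<or> forces r (- A n)"
        using assms le_in_P unfolding decided_def by blast
      then show "\<exists>r. r \<preceq> q \<and> forces r (- A n)" using False q le_trans by blast
    qed
    then have "forces p (\<Inter>n. - A n)" by (rule forces_INT)
    then have "forces p (- (\<Union>n. A n))" by (simp only: Compl_UN)
    then show ?thesis using p le_refl[OF p] by blast
  qed
qed

section \<open>The Baire property of Borel sets\<close>

lemma openin_Gen_basic: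
  assumes U: "openin (Gen_topology M P R) U" and G: "G \<in> U"
  obtains A where "finite A" "A \<subseteq> elts P"
    "\<And>H. H \<in> Gen M P R \<Longrightarrow> H \<inter> A = G \<inter> A \<Longrightarrow> H \<in> U"
proof -
  let ?\<chi> = "\<lambda>G. \<lambda>p\<in>elts P. p \<in> G"
  let ?X = "\<lambda>_::hset. discrete_topology (UNIV :: bool set)"
  obtain V where V: "openin (product_topology ?X (elts P)) V"
      "U = (?\<chi> -` V \<inter> Pow (elts P)) \<inter> Gen M P R"
    using U unfolding Gen_topology_def powerset_topology_def openin_subtopology openin_pullback_topology
    by blast
  have "?\<chi> G \<in> V" using G V by blast
  from V(1)[unfolded openin_product_topology_alt, THEN bspec, OF this]
  obtain W where W: "finite {i \<in> elts P. W i \<noteq> topspace (?X i)}"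
      "?\<chi> G \<in> Pi\<^sub>E (elts P) W" "Pi\<^sub>E (elts P) W \<subseteq> V"
    by (elim exE conjE)
  \<comment> \<open>These finitely many coordinates are the only ones that the basic product set
    restricts.\<close>
  let ?A = "{i \<in> elts P. W i \<noteq> topspace (?X i)}"
  show ?thesis
  proof (rule that[OF W(1)])
    fix H assume H: "H \<in> Gen M P R" "H \<inter> ?A = G \<inter> ?A"
    have "?\<chi> H i \<in> W i" if i: "i \<in> elts P" for i
    proof (cases "i \<in> ?A")
      case True
      then have "i \<in> H \<longleftrightarrow> i \<in> G" using H(2) by blast
      then show ?thesis using W(2) i by (auto simp: PiE_iff)
    next
      case False
      then show ?thesis using i by simp
    qed
    then have "?\<chi> H \<in> Pi\<^sub>E (elts P) W" by (intro PiE_I) auto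
    then have "?\<chi> H \<in> V" using W(3) by (rule subsetD[rotated])
    then show "H \<in> U" using V(2) H(1) Gen_props(1)[OF H(1)] by simp
  qed auto
qed

lemma decided_open:
  assumes U: "openin (Gen_topology M P R) U"
  shows "decided U"
  unfolding decided_def
proof (intro ballI)
  fix p assume p: "p \<in> elts P"
  show "\<exists>q\<in>elts P. q \<preceq> p \<and> (forces q U \<or> forces q (- U))"
  proof (cases "\<exists>q. q \<preceq> p \<and> (\<forall>G\<in>Gen M P R. q \<in> G \<longrightarrow> G \<in> U)")
    case True
    then obtain q where q: "q \<preceq> p" "\<forall>G\<in>Gen M P R. q \<in> G \<longrightarrow> G \<in> U" by blast
    then have "forces q U" unfolding forces_def
      by (intro exI[of _ "{}"]) (auto simp: dense_family_def Gen_for_def)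
    then show ?thesis using q le_in_P by blast
  next
    case False
    \<comment> \<open>\<open>D r\<close> consists of the conditions deciding whether
      \<open>r\<close> is in the generic filter. Including these sets in the family avoids checking
      that they lie in \<open>M\<close>.\<close>
    define D where "D r = {q \<in> elts P. q \<in> {q. q \<preceq> r} \<or> \<not> compatible P R q r}" for r
    have D: "dense_in_order P R (D r)" for r
      unfolding D_def using le_refl le_in_P by (intro dense_below_or_incompatible) blast
    have "G \<notin> U" if G: "G \<in> Gen_for (D ` elts P)" "p \<in> G" for G
    proof
      assume GU: "G \<in> U"
      have Gg: "G \<in> Gen M P R" using G Gen_forD by blast
      obtain A where A: "finite A" "A \<subseteq> elts P"
          "\<And>H. H \<in> Gen M P R \<Longrightarrow> H \<inter> A = G \<inter> A \<Longrightarrow> H \<in> U"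
        using openin_Gen_basic[OF U GU] by blast
      \<comment> \<open>As \<open>A\<close> is finite, one condition of \<open>G\<close> decides all
        of it; every generic filter through that condition then agrees with \<open>G\<close> on
        \<open>A\<close> and so lies in \<open>U\<close>.\<close>
      have "\<exists>q\<in>G. q \<preceq> p \<and> (\<forall>r\<in>A. q \<preceq> r \<or> \<not> compatible P R q r)"
        using A(1,2)
      proof (induction A rule: finite_induct)
        case empty
        then show ?case using G p le_refl by blast
      next
        case (insert r A)
        then obtain q where q: "q \<in> G" "q \<preceq> p" "\<forall>r\<in>A. q \<preceq> r \<or> \<not> compatible P R q r" by blast
        obtain q' where q': "q' \<in> G" "q' \<in> D r"
          using G(1) insert.prems unfolding Gen_for_def by blast
        obtain s where s: "s \<in> G" "s \<preceq> q" "s \<preceq> q'" using Gen_props(3)[OF Gg q(1) q'(1)] by blast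
        have mono: "s \<preceq> t \<or> \<not> compatible P R s t" if "u \<preceq> t \<or> \<not> compatible P R u t" "s \<preceq> u" for u t
          using that le_trans unfolding compatible_def by blast
        have "s \<preceq> r \<or> \<not> compatible P R s r" using mono[OF _ s(3)] q'(2) by (simp add: D_def)
        moreover have "\<forall>r\<in>A. s \<preceq> r \<or> \<not> compatible P R s r" using mono[OF _ s(2)] q(3) by simp
        ultimately show ?case using s q(2) le_trans by blast
      qed
      then obtain q where q: "q \<in> G" "q \<preceq> p" "\<forall>r\<in>A. q \<preceq> r \<or> \<not> compatible P R q r" by blast
      have agree: "r \<in> H \<longleftrightarrow> q \<preceq> r" if "H \<in> Gen M P R" "q \<in> H" "r \<in> A" for H r
      proof
        assume "r \<in> H"
        then have "compatible P R q r"
          using Gen_props[OF that(1)] that(2) unfolding compatible_def by blast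
        then show "q \<preceq> r" using q(3) that(3) by blast
      qed (use Gen_props(2)[OF that(1,2)] in blast)
      have "H \<in> U" if H: "H \<in> Gen M P R" "q \<in> H" for H
        using A(3)[OF H(1)] agree[OF H] agree[OF Gg q(1)] by blast
      with False q(2) show False by blast
    qed
    then have "forces p (- U)" unfolding forces_def
      using D by (intro exI[of _ "D ` elts P"]) (auto simp: dense_family_def)
    then show ?thesis using p le_refl by blast
  qed
qed

lemma decided_borel:
  assumes "A \<in> sets (borel_of (Gen_topology M P R))"
  shows "decided A"
proof -
  have "{U. openin (Gen_topology M P R) U} \<subseteq> Pow (topspace (Gen_topology M P R))"
    using openin_subset by blast
  then have "A \<in> sigma_sets (Gen M P R) {U. openin (Gen_topology M P R) U}"
    using assms unfolding borel_of_def by simp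
  then show ?thesis
  proof induction
    case (Basic U)
    then show ?case using decided_open by simp
  next
    case Empty
    then show ?case by (rule decided_open[OF openin_empty])
  next
    case (Compl U)
    have "decided (Gen M P R)" using decided_open[OF openin_topspace] by simp
    \<comment> \<open>The relative complement is rewritten through an absolute complement and a
      countable union, the operations covered so far.\<close>
    then have "decided (- (\<Union>n::nat. if n = 0 then - Gen M P R else U))"
      using decided_Compl Compl by (intro decided_Compl decided_UN) auto
    also have "- (\<Union>n::nat. if n = 0 then - Gen M P R else U) = Gen M P R - U"
      by (auto split: if_splits) 
    finally show ?case .
  next
    case (Union A)
    then show ?case by (intro decided_UN)
  qed
qed

text \<open>An automorphism in \<open>M\<close> maps a comeagre piece of an invariant set onto a comeagre piece of the
  same set; with weak homogeneity this yields the zero-one law.\<close>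

lemma forces_automorphism:
  assumes p: "p \<in> elts P" "forces p A"
    and e: "automorphism P R e" "fun_graph P e \<in> M"
    and inv: "\<And>G H. G \<in> Gen M P R \<Longrightarrow> H \<in> Gen M P R \<Longrightarrow> gen_equiv M P G H \<Longrightarrow> G \<in> A \<Longrightarrow> H \<in> A"
  shows "forces (e p) A"
proof -
  obtain \<D> where \<D>: "dense_family \<D>" "\<forall>G\<in>Gen_for \<D>. p \<in> G \<longrightarrow> G \<in> A"
    using p(2) unfolding forces_def by blast
  let ?i = "inv_into (elts P) e"
  have bij: "bij_betw e (elts P) (elts P)" using e(1) by (simp add: automorphism_def)
  have mono: "\<And>p q. p \<in> elts P \<Longrightarrow> q \<in> elts P \<Longrightarrow> p \<preceq> q \<longleftrightarrow> e p \<preceq> e q"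
    using e(1) by (simp add: automorphism_def)
  have ie: "?i (e x) = x" if "x \<in> elts P" for x using bij that by (simp add: bij_betw_def)
  have ei: "e (?i x) = x" "?i x \<in> elts P" if "x \<in> elts P" for x
    using bij that by (simp_all add: bij_betw_def f_inv_into_f inv_into_into)
  have into: "e x \<in> elts P" if "x \<in> elts P" for x using bij that by (auto simp: bij_betw_def)
  have "automorphism P R ?i"
    unfolding automorphism_def using bij_betw_inv_into[OF bij] mono ei by metis
  have "dense_in_order P R (e ` D)" if "D \<in> \<D>" for D
    unfolding dense_in_order_def
  proof (intro conjI ballI)
    have D: "dense_in_order P R D" using \<D> that by (simp add: dense_family_def)
    then show "e ` D \<subseteq> elts P" using into by (auto simp: dense_in_order_def)
    fix x assume x: "x \<in> elts P"
    then obtain d where "d \<in> D" "d \<preceq> ?i x" using D ei(2) unfolding dense_in_order_def by blast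
    then have "e d \<preceq> x" using mono[of d "?i x"] le_in_P x ei by metis
    then show "\<exists>d\<in>e ` D. d \<preceq> x" using \<open>d \<in> D\<close> by blast
  qed
  then have "dense_family ((`) e ` \<D>)" using \<D> by (auto simp: dense_family_def)
  moreover have "G \<in> A" if G: "G \<in> Gen_for ((`) e ` \<D>)" "e p \<in> G" for G
  proof -
    have Gg: "G \<in> Gen M P R" using G Gen_forD by blast
    \<comment> \<open>The preimage of \<open>G\<close> under \<open>e\<close> is generic, contains
      \<open>p\<close> and has the same extension, so invariance carries membership in
      \<open>A\<close> over to \<open>G\<close>.\<close>
    have H: "?i ` G \<in> Gen M P R"
      using Gen_image[OF P_in_M Gg \<open>automorphism P R ?i\<close> inverse_graph_in_M[OF P_in_M bij e(2)]] .
    have "?i ` G \<inter> D \<noteq> {}" if "D \<in> \<D>" for D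
    proof -
      have "G \<inter> e ` D \<noteq> {}" using G that by (auto simp: Gen_for_def)
      then obtain d where d: "d \<in> D" "e d \<in> G" by blast
      moreover have "d \<in> elts P" using d(1) \<D>(1) that by (auto simp: dense_family_def dense_in_order_def)
      ultimately show ?thesis using ie by (metis IntI empty_iff imageI)
    qed
    then have "?i ` G \<in> Gen_for \<D>" using H by (simp add: Gen_for_def)
    moreover have "p \<in> ?i ` G" using ie[OF p(1)] G(2) by (metis imageI)
    ultimately have "?i ` G \<in> A" using \<D>(2) by blast
    moreover have "gen_equiv M P (?i ` G) G"
      using gen_equiv_image[OF P_in_M bij_betw_inv_into[OF bij] inverse_graph_in_M[OF P_in_M bij e(2)] Gen_props(1)[OF Gg]]
      by (simp add: gen_equiv_def)
    ultimately show ?thesis using inv[OF H Gg] by blast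
  qed
  ultimately show ?thesis unfolding forces_def by blast
qed

lemma zero_one_law:
  assumes hom: "weakly_homogeneous_in M P R" and dec: "decided A"
    and inv: "\<And>G H. G \<in> Gen M P R \<Longrightarrow> H \<in> Gen M P R \<Longrightarrow> gen_equiv M P G H \<Longrightarrow> G \<in> A \<longleftrightarrow> H \<in> A"
  shows "\<exists>\<D>. dense_family \<D> \<and> (Gen_for \<D> \<subseteq> A \<or> Gen_for \<D> \<subseteq> - A)"
proof -
  have no_split: False if pq: "p \<in> elts P" "q \<in> elts P" "forces p A" "forces q (- A)" for p q
  proof -
    obtain e where e: "automorphism P R e" "fun_graph P e \<in> M" "compatible P R (e p) q"
      using hom pq unfolding weakly_homogeneous_in_def by blast
    then obtain r where r: "r \<in> elts P" "r \<preceq> e p" "r \<preceq> q" by (auto simp: compatible_def)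
    have "forces (e p) A" using forces_automorphism[OF pq(1,3) e(1,2)] inv by blast
    then show False using forces_consistent[OF r(1)] forces_le r pq(4) by blast
  qed
  \<comment> \<open>Every filter contains some condition, so uniting the families of the countably
    many conditions passes from local to global.\<close>
  have all: "\<exists>\<D>. dense_family \<D> \<and> Gen_for \<D> \<subseteq> B" if B: "\<And>p. p \<in> elts P \<Longrightarrow> forces p B" for B
  proof -
    have "\<forall>p\<in>elts P. \<exists>\<D>. dense_family \<D> \<and> (\<forall>G\<in>Gen_for \<D>. p \<in> G \<longrightarrow> G \<in> B)"
      using B unfolding forces_def by blast
    then obtain \<D> where \<D>: "\<forall>p\<in>elts P. dense_family (\<D> p) \<and> (\<forall>G\<in>Gen_for (\<D> p). p \<in> G \<longrightarrow> G \<in> B)"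
      by (elim bchoice[THEN exE])
    have "dense_family (\<Union>p\<in>elts P. \<D> p)" using \<D> by (intro dense_family_UN) auto
    moreover have "Gen_for (\<Union>p\<in>elts P. \<D> p) \<subseteq> B"
    proof
      fix G assume G: "G \<in> Gen_for (\<Union>p\<in>elts P. \<D> p)"
      then have "G \<noteq> {}" "G \<subseteq> elts P" by (auto simp: Gen_for_def Gen_def filter_in_order_def)
      then obtain p where "p \<in> G" "p \<in> elts P" by blast
      then show "G \<in> B" using G \<D> by (auto simp: Gen_for_UN)
    qed
    ultimately show ?thesis by blast
  qed
  show ?thesis
  proof (cases "\<exists>p\<in>elts P. forces p A")
    case True
    have "forces p A" for p
    proof (rule forces_of_dense_below)
      fix q assume "q \<preceq> p"
      then obtain r where r: "r \<in> elts P" "r \<preceq> q" "forces r A \<or> forces r (- A)"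
        using dec le_in_P[of q p] unfolding decided_def by blast
      then show "\<exists>r. r \<preceq> q \<and> forces r A" using True no_split by blast
    qed
    then show ?thesis using all[of A] by blast
  next
    case False
    have "forces p (- A)" for p
    proof (rule forces_of_dense_below)
      fix q assume "q \<preceq> p"
      then obtain r where r: "r \<in> elts P" "r \<preceq> q" "forces r A \<or> forces r (- A)"
        using dec le_in_P[of q p] unfolding decided_def by blast
      then show "\<exists>r. r \<preceq> q \<and> forces r (- A)" using False by blast
    qed
    then show ?thesis using all[of "- A"] by blast
  qed
qed

text \<open>Of two incompatible conditions a filter \<open>H\<close> omits at least one, so
  \<open>elts P - H\<close> is dense. Meeting it forces a filter to differ from
  \<open>H\<close>.\<close>

lemma ex_Gen_avoiding:
  assumes atomless: "atomless P R" and C: "countable C" "C \<subseteq> Gen M P R" and \<D>: "dense_family \<D>"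
  shows "\<exists>G\<in>Gen_for \<D>. G \<notin> C"
proof -
  have "dense_in_order P R (elts P - H)" if "H \<in> C" for H
    unfolding dense_in_order_def
  proof (intro conjI ballI)
    fix p assume "p \<in> elts P"
    then obtain q r where qr: "q \<in> elts P" "r \<in> elts P" "q \<preceq> p" "r \<preceq> p" "\<not> compatible P R q r"
      using atomless unfolding atomless_def by blast
    have H: "H \<in> Gen M P R" using that C by blast
    have "\<not> (q \<in> H \<and> r \<in> H)" using qr(5) Gen_props[OF H] unfolding compatible_def by blast
    then show "\<exists>d\<in>elts P - H. d \<preceq> p" using qr by blast
  qed auto
  then have "dense_family (\<D> \<union> (\<lambda>H. elts P - H) ` C)"
    using C(1) \<D> by (intro dense_family_Un) (auto simp: dense_family_def)
  moreover have "elts P \<noteq> {}" using partial_order by (auto simp: partial_order_in_def)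
  ultimately obtain G where "G \<in> Gen_for (\<D> \<union> (\<lambda>H. elts P - H) ` C)"
    using ex_Gen_for by blast
  then have "G \<in> Gen_for \<D>" "\<And>H. H \<in> C \<Longrightarrow> G \<inter> (elts P - H) \<noteq> {}"
    unfolding Gen_for_def by blast+
  then show ?thesis by blast
qed

end

theorem theorem2p12:
  fixes M :: "hset set" and P R :: hset
  assumes "ctm M"
    and "partial_order_in M P R"
    and "atomless P R"
    and "weakly_homogeneous_in M P R"
  shows "\<not> smooth (Gen_topology M P R) (gen_equiv M P)"
proof
  assume "smooth (Gen_topology M P R) (gen_equiv M P)"
  interpret forcing M P R by unfold_locales (fact assms)+
  obtain f :: "hset set \<Rightarrow> real" where
    f: "f \<in> borel_of (Gen_topology M P R) \<rightarrow>\<^sub>M borel_of euclidean"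
    and red: "\<forall>G\<in>Gen M P R. \<forall>H\<in>Gen M P R. gen_equiv M P G H \<longleftrightarrow> f G = f H"
    using \<open>smooth _ _\<close> unfolding smooth_def borel_reducible_def topspace_Gen_topology by (elim exE conjE)
  define A where "A r = f -` {..<r} \<inter> Gen M P R" for r
  have "{..<r} \<in> sets (borel_of (euclidean :: real topology))" for r :: real
    unfolding borel_of_def by (auto intro!: sigma_sets.Basic)
  then have "A r \<in> sets (borel_of (Gen_topology M P R))" for r
    using measurable_sets[OF f, of "{..<r}"] by (simp add: A_def borel_of_def space_measure_of_conv)
  then have "decided (A r)" for r by (rule decided_borel)
  moreover have "G \<in> A r \<longleftrightarrow> H \<in> A r"
    if "G \<in> Gen M P R" "H \<in> Gen M P R" "gen_equiv M P G H" for G H r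
    using red[THEN bspec, THEN bspec, OF that(1,2)] that by (simp add: A_def)
  ultimately have "\<forall>r. \<exists>\<D>. dense_family \<D> \<and> (Gen_for \<D> \<subseteq> A r \<or> Gen_for \<D> \<subseteq> - A r)"
    by (intro allI zero_one_law assms(4))
  then obtain \<D> where \<D>: "\<forall>r. dense_family (\<D> r) \<and> (Gen_for (\<D> r) \<subseteq> A r \<or> Gen_for (\<D> r) \<subseteq> - A r)"
    by (elim choice[THEN exE])
  \<comment> \<open>Rational levels keep the union countable and still separate any two distinct
    values of \<open>f\<close>.\<close>
  define \<E> where "\<E> = (\<Union>r\<in>\<rat>. \<D> r)"
  have \<E>: "dense_family \<E>" unfolding \<E>_def using \<D> countable_rat by (intro dense_family_UN) auto
  have less: False if "G \<in> Gen_for \<E>" "H \<in> Gen_for \<E>" "f G < f H" for G H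
  proof -
    obtain r where r: "r \<in> \<rat>" "f G < r" "r < f H" using Rats_dense_in_real[OF \<open>f G < f H\<close>] by blast
    have "G \<in> Gen_for (\<D> r)" "H \<in> Gen_for (\<D> r)" using that r(1) unfolding \<E>_def Gen_for_UN by blast+
    moreover have "G \<in> A r" "H \<notin> A r" using r Gen_forD[OF that(1)] by (simp_all add: A_def)
    ultimately show False using \<D>[THEN spec, of r] by blast
  qed
  have const: "f G = f H" if "G \<in> Gen_for \<E>" "H \<in> Gen_for \<E>" for G H
    using less[OF that] less[OF that(2,1)] by (cases "f G" "f H" rule: linorder_cases) auto
  have "elts P \<noteq> {}" using assms(2) by (auto simp: partial_order_in_def)
  then obtain G0 where G0: "G0 \<in> Gen_for \<E>" using ex_Gen_for[OF \<E>] by blast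
  \<comment> \<open>All of \<open>Gen_for \<E>\<close> lies in this one class, yet a countable class
    cannot cover it.\<close>
  let ?C = "{H \<in> Gen M P R. gen_equiv M P G0 H}"
  obtain G where G: "G \<in> Gen_for \<E>" "G \<notin> ?C"
    using ex_Gen_avoiding[OF assms(3) countable_gen_equiv_class[OF P_in_M] _ \<E>] by auto
  have "gen_equiv M P G0 G"
    using red[THEN bspec, THEN bspec, OF Gen_forD[OF G0] Gen_forD[OF G(1)]] const[OF G0 G(1)] by simp
  then show False using G Gen_forD[OF G(1)] by simp
qed

end
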